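(* Let $T$ be a self-adjoint and boundedly invertible operator in the Hilbert space $(H,(\cdot,\cdot))$. Let $\mathcal M_T$ be the set of all closures $\mathfrak t[\cdot,\cdot]$ in $(H,(\cdot,\cdot))$ of the form $(T\cdot,\cdot)$ defined on $\operatorname{dom}T$. Let $\mathcal N_T$ be the set of all triples $(K,[\cdot,\cdot],A)$ such that $(K,[\cdot,\cdot])$ is a Krein space completion of $(\operatorname{dom}T,(T\cdot,\cdot))$ which is continuously embedded in $(H,(\cdot,\cdot))$, and $A=T|_{\operatorname{dom}A}$ with $\operatorname{dom}A=T^{-1}(K)$. Then the mapping $\Phi_T:\mathcal M_T\to\mathcal N_T$ given by the rule $$K:=\operatorname{dom}\mathfrak t,\qquad[\cdot,\cdot]:=\mathfrak t[\cdot,\cdot],\qquad A:=A_{\mathfrak t}$$ is bijective. Moreover, $$\mathcal N_T\subset\mathcal N,\qquad \mathcal M_T=\{\mathfrak t[\cdot,\cdot]\;|\;(H,(\cdot,\cdot),\mathfrak t[\cdot,\cdot])\in\mathcal M,\ T_{\mathfrak t}=T\},$$ where $\mathcal M$ is the collection of all triples consisting of a Hilbert space with its inner product and a closed symmetric form in it with gap point $0$, and $\mathcal N$ is the collection of all triples $(K,[\cdot,\cdot],A)$ consisting of a Krein space $(K,[\cdot,\cdot])$ and a J-non-negative, J-self-adjoint and boundedly invertible operator $A$ in it.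
   Context: All spaces are complex; sesquilinear forms are linear in the first argument. "Boundedly invertible" means having an everywhere defined bounded inverse. Krein spaces. $(K,[\cdot,\cdot])$ is a Krein space if $K=K^+\oplus K^-$ (direct, $[\cdot,\cdot]$-orthogonal) with $(K^+,[\cdot,\cdot])$ and $(K^-,-[\cdot,\cdot])$ Hilbert spaces. With the projections $P^\pm$ onto $K^\pm$, $J:=P^+-P^-$ is a fundamental symmetry and $\{\cdot,\cdot\}:=[J\cdot,\cdot]$ is a Hilbert space inner product on $K$; its topology (independent of $J$) is the topology of $K$. A densely defined operator $A$ in $K$ is J-self-adjoint (J-non-negative) if $JA$ is self-adjoint (non-negative) in $(K,\{\cdot,\cdot\})$. A Krein space $(K,[\cdot,\cdot])$ is a Krein space completion of an inner product space $(\widetilde K,[\cdot,\cdot]^\sim)$ if $\widetilde K$ is a dense subspace of $K$ and $[\cdot,\cdot]$ and $[\cdot,\cdot]^\sim$ coincide on $\widetilde K$. Forms. A form is a densely defined symmetric sesquilinear form $\mathfrak t[\cdot,\cdot]$ with domain $\operatorname{dom}\mathfrak t$ in a Hilbert space $(H,(\cdot,\cdot))$. Put $\mathfrak t_\lambda[\cdot,\cdot]:=\mathfrak t[\cdot,\cdot]-\lambda(\cdot,\cdot)$. The form is closed if for some $\lambda\in\mathbb R$ (called a gap point of $\mathfrak t$) $(\operatorname{dom}\mathfrak t,\mathfrak t_\lambda[\cdot,\cdot])$ is a Krein space continuously embedded in $(H,(\cdot,\cdot))$. A closed extension $\mathfrak t$ of a form $\tilde{\mathfrak t}$ is a closure of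 $\tilde{\mathfrak t}$ if $\operatorname{dom}\tilde{\mathfrak t}$ is dense in the Krein space $(\operatorname{dom}\mathfrak t,\mathfrak t_\lambda[\cdot,\cdot])$ for some gap point $\lambda$ (the definition does not depend on the gap point). For a closed form there is a unique self-adjoint operator $T_{\mathfrak t}$ in $H$ (the representing operator) with $\operatorname{dom}T_{\mathfrak t}\subset\operatorname{dom}\mathfrak t$ and $\mathfrak t[u,v]=(T_{\mathfrak t}u,v)$ for $u\in\operatorname{dom}T_{\mathfrak t}$, $v\in\operatorname{dom}\mathfrak t$. The range restriction $A_{\mathfrak t}$ is the restriction of $T_{\mathfrak t}$ to $\operatorname{dom}A_{\mathfrak t}:=\{f\in\operatorname{dom}T_{\mathfrak t}:T_{\mathfrak t}f\in\operatorname{dom}\mathfrak t\}$. *)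

theory Defs
  imports "HOL-Analysis.Analysis"
begin

text \<open>All spaces below are linear subspaces of an ambient complex vector space (a type of class
  complex_vector), so that one space can literally be a subspace of another one. The ambient
  type carries no topology; all topologies come from inner products on the carriers.\<close>

class complex_vector = ab_group_add +
  fixes scaleC :: "complex \<Rightarrow> 'a \<Rightarrow> 'a"  (infixr \<open>*\<^sub>C\<close> 75)
  assumes scaleC_add_right: "a *\<^sub>C (x + y) = a *\<^sub>C x + a *\<^sub>C y"
    and scaleC_add_left: "(a + b) *\<^sub>C x = a *\<^sub>C x + b *\<^sub>C x"
    and scaleC_scaleC: "a *\<^sub>C (b *\<^sub>C x) = (a * b) *\<^sub>C x"
    and scaleC_one: "1 *\<^sub>C x = x"

global_interpretation complex_vector: vector_space "scaleC :: complex \<Rightarrow> 'a \<Rightarrow> 'a::complex_vector"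
  by unfold_locales
    (auto simp: scaleC_add_right scaleC_add_left scaleC_scaleC scaleC_one)


section \<open>Inner product spaces and Hilbert spaces\<close>

text \<open>A form on \<open>V\<close> is literally a function on \<open>V \<times> V\<close>: it is extensional, i.e. undefined
  outside \<open>V\<close>. Hence two forms with the same domain are equal as soon as they agree on it.\<close>

definition hermitian_form :: "'a::complex_vector set \<Rightarrow> ('a \<Rightarrow> 'a \<Rightarrow> complex) \<Rightarrow> bool" where
  "hermitian_form V ip \<longleftrightarrow>
     ip \<in> V \<rightarrow>\<^sub>E V \<rightarrow>\<^sub>E UNIV \<and>
     (\<forall>x\<in>V. \<forall>y\<in>V. \<forall>z\<in>V. ip (x + y) z = ip x z + ip y z) \<and>
     (\<forall>c. \<forall>x\<in>V. \<forall>y\<in>V. ip (c *\<^sub>C x) y = c * ip x y) \<and>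
     (\<forall>x\<in>V. \<forall>y\<in>V. ip y x = cnj (ip x y))"

definition inner_product_space :: "'a::complex_vector set \<Rightarrow> ('a \<Rightarrow> 'a \<Rightarrow> complex) \<Rightarrow> bool" where
  "inner_product_space V ip \<longleftrightarrow> complex_vector.subspace V \<and> hermitian_form V ip"

text \<open>The metric of a positive definite inner product. The modulus and the value 0 off \<open>V\<close> are
  only there to meet the requirement of the locale Metric_space that the distance function be
  non-negative and symmetric on the whole type.\<close>

definition ip_dist :: "'a::complex_vector set \<Rightarrow> ('a \<Rightarrow> 'a \<Rightarrow> complex) \<Rightarrow> 'a \<Rightarrow> 'a \<Rightarrow> real" where
  "ip_dist V ip x y =
     (if x \<in> V \<and> y \<in> V then sqrt (cmod (ip (x - y) (x - y))) else 0)"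

definition ip_topology :: "'a::complex_vector set \<Rightarrow> ('a \<Rightarrow> 'a \<Rightarrow> complex) \<Rightarrow> 'a topology" where
  "ip_topology V ip = Metric_space.mtopology V (ip_dist V ip)"

definition hilbert_space :: "'a::complex_vector set \<Rightarrow> ('a \<Rightarrow> 'a \<Rightarrow> complex) \<Rightarrow> bool" where
  "hilbert_space V ip \<longleftrightarrow>
     inner_product_space V ip \<and>
     (\<forall>x\<in>V. x \<noteq> 0 \<longrightarrow> 0 < Re (ip x x)) \<and>
     Metric_space.mcomplete V (ip_dist V ip)"


section \<open>Operators\<close>

text \<open>Operators are identified with their graphs.\<close>

definition linear_operator :: "'a::complex_vector set \<Rightarrow> ('a \<times> 'a) set \<Rightarrow> bool" where
  "linear_operator V A \<longleftrightarrow>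
     A \<subseteq> V \<times> V \<and> single_valued A \<and> (0, 0) \<in> A \<and>
     (\<forall>(x, y)\<in>A. \<forall>(x', y')\<in>A. (x + x', y + y') \<in> A) \<and>
     (\<forall>c. \<forall>(x, y)\<in>A. (c *\<^sub>C x, c *\<^sub>C y) \<in> A)"

definition op_app :: "('a \<times> 'a) set \<Rightarrow> 'a \<Rightarrow> 'a" where
  "op_app A x = (THE y. (x, y) \<in> A)"

definition op_restrict :: "('a \<times> 'a) set \<Rightarrow> 'a set \<Rightarrow> ('a \<times> 'a) set" where
  "op_restrict A S = {(x, y) \<in> A. x \<in> S}"

definition densely_defined :: "'a topology \<Rightarrow> ('a \<times> 'a) set \<Rightarrow> bool" where
  "densely_defined X A \<longleftrightarrow> X closure_of (Domain A) = topspace X"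

definition op_adjoint ::
  "'a::complex_vector set \<Rightarrow> ('a \<Rightarrow> 'a \<Rightarrow> complex) \<Rightarrow> ('a \<times> 'a) set \<Rightarrow> ('a \<times> 'a) set" where
  "op_adjoint H ip A = {(v, w). v \<in> H \<and> w \<in> H \<and> (\<forall>(x, y)\<in>A. ip y v = ip x w)}"

definition self_adjoint ::
  "'a::complex_vector set \<Rightarrow> ('a \<Rightarrow> 'a \<Rightarrow> complex) \<Rightarrow> ('a \<times> 'a) set \<Rightarrow> bool" where
  "self_adjoint H ip A \<longleftrightarrow>
     linear_operator H A \<and> densely_defined (ip_topology H ip) A \<and> op_adjoint H ip A = A"

definition non_negative_op ::
  "('a \<Rightarrow> 'a \<Rightarrow> complex) \<Rightarrow> ('a \<times> 'a) set \<Rightarrow> bool" where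
  "non_negative_op ip A \<longleftrightarrow> (\<forall>(x, y)\<in>A. ip y x \<in> \<real>\<^sub>\<ge>\<^sub>0)"

definition boundedly_invertible ::
  "'a::complex_vector set \<Rightarrow> ('a \<Rightarrow> 'a \<Rightarrow> complex) \<Rightarrow> ('a \<times> 'a) set \<Rightarrow> bool" where
  "boundedly_invertible H ip A \<longleftrightarrow>
     linear_operator H A \<and> single_valued (A\<inverse>) \<and> Range A = H \<and>
     (\<exists>C. \<forall>(x, y)\<in>A. ip_dist H ip x 0 \<le> C * ip_dist H ip y 0)"


section \<open>Krein spaces\<close>

definition fundamental_decomposition ::
  "'a::complex_vector set \<Rightarrow> ('a \<Rightarrow> 'a \<Rightarrow> complex) \<Rightarrow> 'a set \<Rightarrow> 'a set \<Rightarrow> bool" where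
  "fundamental_decomposition K ip Kp Km \<longleftrightarrow>
     Kp \<subseteq> K \<and> Km \<subseteq> K \<and>
     K = {x + y | x y. x \<in> Kp \<and> y \<in> Km} \<and> Kp \<inter> Km = {0} \<and>
     (\<forall>x\<in>Kp. \<forall>y\<in>Km. ip x y = 0) \<and>
     hilbert_space Kp (\<lambda>x\<in>Kp. \<lambda>y\<in>Kp. ip x y) \<and>
     hilbert_space Km (\<lambda>x\<in>Km. \<lambda>y\<in>Km. - ip x y)"

definition krein_space :: "'a::complex_vector set \<Rightarrow> ('a \<Rightarrow> 'a \<Rightarrow> complex) \<Rightarrow> bool" where
  "krein_space K ip \<longleftrightarrow>
     inner_product_space K ip \<and> (\<exists>Kp Km. fundamental_decomposition K ip Kp Km)"

text \<open>The projection onto \<open>Kp\<close> along \<open>Km\<close>.\<close>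

definition projection :: "'a::complex_vector set \<Rightarrow> 'a set \<Rightarrow> 'a \<Rightarrow> 'a" where
  "projection Kp Km x = (THE p. p \<in> Kp \<and> x - p \<in> Km)"

definition fundamental_symmetry ::
  "'a::complex_vector set \<Rightarrow> ('a \<Rightarrow> 'a \<Rightarrow> complex) \<Rightarrow> ('a \<Rightarrow> 'a) \<Rightarrow> bool" where
  "fundamental_symmetry K ip J \<longleftrightarrow>
     (\<exists>Kp Km. fundamental_decomposition K ip Kp Km \<and>
        J = (\<lambda>x\<in>K. projection Kp Km x - projection Km Kp x))"

text \<open>A fixed, but arbitrary, fundamental symmetry, and the Hilbert space inner product that it
  induces. None of the notions derived from it depends on the choice.\<close>

definition fund_sym ::
  "'a::complex_vector set \<Rightarrow> ('a \<Rightarrow> 'a \<Rightarrow> complex) \<Rightarrow> 'a \<Rightarrow> 'a" where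
  "fund_sym K ip = (SOME J. fundamental_symmetry K ip J)"

definition hilbert_ip ::
  "'a::complex_vector set \<Rightarrow> ('a \<Rightarrow> 'a \<Rightarrow> complex) \<Rightarrow> 'a \<Rightarrow> 'a \<Rightarrow> complex" where
  "hilbert_ip K ip = (\<lambda>x\<in>K. \<lambda>y\<in>K. ip (fund_sym K ip x) y)"

definition krein_topology ::
  "'a::complex_vector set \<Rightarrow> ('a \<Rightarrow> 'a \<Rightarrow> complex) \<Rightarrow> 'a topology" where
  "krein_topology K ip = ip_topology K (hilbert_ip K ip)"

text \<open>The operator \<open>J A\<close>.\<close>

definition J_op ::
  "'a::complex_vector set \<Rightarrow> ('a \<Rightarrow> 'a \<Rightarrow> complex) \<Rightarrow> ('a \<times> 'a) set \<Rightarrow> ('a \<times> 'a) set" where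
  "J_op K ip A = {(x, fund_sym K ip y) | x y. (x, y) \<in> A}"

definition J_self_adjoint ::
  "'a::complex_vector set \<Rightarrow> ('a \<Rightarrow> 'a \<Rightarrow> complex) \<Rightarrow> ('a \<times> 'a) set \<Rightarrow> bool" where
  "J_self_adjoint K ip A \<longleftrightarrow>
     linear_operator K A \<and> densely_defined (krein_topology K ip) A \<and>
     self_adjoint K (hilbert_ip K ip) (J_op K ip A)"

definition J_non_negative ::
  "'a::complex_vector set \<Rightarrow> ('a \<Rightarrow> 'a \<Rightarrow> complex) \<Rightarrow> ('a \<times> 'a) set \<Rightarrow> bool" where
  "J_non_negative K ip A \<longleftrightarrow>
     linear_operator K A \<and> densely_defined (krein_topology K ip) A \<and>
     non_negative_op (hilbert_ip K ip) (J_op K ip A)"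

definition krein_completion ::
  "'a::complex_vector set \<Rightarrow> ('a \<Rightarrow> 'a \<Rightarrow> complex) \<Rightarrow>
   'a set \<Rightarrow> ('a \<Rightarrow> 'a \<Rightarrow> complex) \<Rightarrow> bool" where
  "krein_completion K ip K' ip' \<longleftrightarrow>
     krein_space K ip \<and> complex_vector.subspace K' \<and> K' \<subseteq> K \<and>
     krein_topology K ip closure_of K' = K \<and>
     (\<forall>x\<in>K'. \<forall>y\<in>K'. ip x y = ip' x y)"

definition continuously_embedded ::
  "'a::complex_vector set \<Rightarrow> ('a \<Rightarrow> 'a \<Rightarrow> complex) \<Rightarrow>
   'a set \<Rightarrow> ('a \<Rightarrow> 'a \<Rightarrow> complex) \<Rightarrow> bool" where
  "continuously_embedded K ip H ipH \<longleftrightarrow>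
     K \<subseteq> H \<and> continuous_map (krein_topology K ip) (ip_topology H ipH) (\<lambda>x. x)"


section \<open>Forms in a Hilbert space\<close>

text \<open>In the following definitions \<open>H\<close> with \<open>ip\<close> is the Hilbert space, and a form is given by its
  domain \<open>D\<close> and its values \<open>t\<close>.\<close>

definition form ::
  "'a::complex_vector set \<Rightarrow> ('a \<Rightarrow> 'a \<Rightarrow> complex) \<Rightarrow>
   'a set \<Rightarrow> ('a \<Rightarrow> 'a \<Rightarrow> complex) \<Rightarrow> bool" where
  "form H ip D t \<longleftrightarrow>
     complex_vector.subspace D \<and> D \<subseteq> H \<and> ip_topology H ip closure_of D = H \<and>
     hermitian_form D t"

definition shifted_form ::
  "('a \<Rightarrow> 'a \<Rightarrow> complex) \<Rightarrow> 'a set \<Rightarrow> ('a \<Rightarrow> 'a \<Rightarrow> complex) \<Rightarrow> real \<Rightarrow> 'a \<Rightarrow> 'a \<Rightarrow> complex" where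
  "shifted_form ip D t l = (\<lambda>u\<in>D. \<lambda>v\<in>D. t u v - of_real l * ip u v)"

definition gap_point ::
  "'a::complex_vector set \<Rightarrow> ('a \<Rightarrow> 'a \<Rightarrow> complex) \<Rightarrow>
   'a set \<Rightarrow> ('a \<Rightarrow> 'a \<Rightarrow> complex) \<Rightarrow> real \<Rightarrow> bool" where
  "gap_point H ip D t l \<longleftrightarrow>
     krein_space D (shifted_form ip D t l) \<and>
     continuously_embedded D (shifted_form ip D t l) H ip"

definition closed_form ::
  "'a::complex_vector set \<Rightarrow> ('a \<Rightarrow> 'a \<Rightarrow> complex) \<Rightarrow>
   'a set \<Rightarrow> ('a \<Rightarrow> 'a \<Rightarrow> complex) \<Rightarrow> bool" where
  "closed_form H ip D t \<longleftrightarrow> form H ip D t \<and> (\<exists>l. gap_point H ip D t l)"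

definition form_extension ::
  "'a set \<Rightarrow> ('a \<Rightarrow> 'a \<Rightarrow> complex) \<Rightarrow> 'a set \<Rightarrow> ('a \<Rightarrow> 'a \<Rightarrow> complex) \<Rightarrow> bool" where
  "form_extension D t D' t' \<longleftrightarrow> D' \<subseteq> D \<and> (\<forall>u\<in>D'. \<forall>v\<in>D'. t u v = t' u v)"

text \<open>The closed form \<open>t\<close> on \<open>D\<close> is a closure of the form \<open>t'\<close> on \<open>D'\<close>.\<close>

definition form_closure ::
  "'a::complex_vector set \<Rightarrow> ('a \<Rightarrow> 'a \<Rightarrow> complex) \<Rightarrow>
   'a set \<Rightarrow> ('a \<Rightarrow> 'a \<Rightarrow> complex) \<Rightarrow> 'a set \<Rightarrow> ('a \<Rightarrow> 'a \<Rightarrow> complex) \<Rightarrow> bool" where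
  "form_closure H ip D t D' t' \<longleftrightarrow>
     closed_form H ip D t \<and> form_extension D t D' t' \<and>
     (\<exists>l. gap_point H ip D t l \<and>
          krein_topology D (shifted_form ip D t l) closure_of D' = D)"

definition representing_operator ::
  "'a::complex_vector set \<Rightarrow> ('a \<Rightarrow> 'a \<Rightarrow> complex) \<Rightarrow>
   'a set \<Rightarrow> ('a \<Rightarrow> 'a \<Rightarrow> complex) \<Rightarrow> ('a \<times> 'a) set" where
  "representing_operator H ip D t =
     (THE S. self_adjoint H ip S \<and> Domain S \<subseteq> D \<and>
        (\<forall>u\<in>Domain S. \<forall>v\<in>D. t u v = ip (op_app S u) v))"

definition range_restriction ::
  "'a::complex_vector set \<Rightarrow> ('a \<Rightarrow> 'a \<Rightarrow> complex) \<Rightarrow>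
   'a set \<Rightarrow> ('a \<Rightarrow> 'a \<Rightarrow> complex) \<Rightarrow> ('a \<times> 'a) set" where
  "range_restriction H ip D t =
     (let S = representing_operator H ip D t
      in op_restrict S {f \<in> Domain S. op_app S f \<in> D})"

text \<open>The values of the form \<open>(T\<cdot>,\<cdot>)\<close> with domain \<open>dom T\<close>.\<close>

definition op_form ::
  "('a \<Rightarrow> 'a \<Rightarrow> complex) \<Rightarrow> ('a \<times> 'a) set \<Rightarrow> 'a \<Rightarrow> 'a \<Rightarrow> complex" where
  "op_form ip T = (\<lambda>u\<in>Domain T. \<lambda>v\<in>Domain T. ip (op_app T u) v)"


section \<open>The collections of triples\<close>

text \<open>A triple \<open>(H, (\<cdot>,\<cdot>), t)\<close> appears as \<open>(H, ip, D, t)\<close>, the form being the pair \<open>(D, t)\<close>.\<close>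

definition Form_triples ::
  "('a::complex_vector set \<times> ('a \<Rightarrow> 'a \<Rightarrow> complex) \<times> 'a set \<times> ('a \<Rightarrow> 'a \<Rightarrow> complex)) set" where
  "Form_triples =
     {(H, ip, D, t). hilbert_space H ip \<and> closed_form H ip D t \<and> gap_point H ip D t 0}"

text \<open>Bounded invertibility in a Krein space refers to the Krein space topology, hence to any of
  its Hilbert space norms.\<close>

definition Krein_triples ::
  "('a::complex_vector set \<times> ('a \<Rightarrow> 'a \<Rightarrow> complex) \<times> ('a \<times> 'a) set) set" where
  "Krein_triples =
     {(K, ip, A). krein_space K ip \<and> J_non_negative K ip A \<and> J_self_adjoint K ip A \<and>
        boundedly_invertible K (hilbert_ip K ip) A}"

definition Closures_of_op ::
  "'a::complex_vector set \<Rightarrow> ('a \<Rightarrow> 'a \<Rightarrow> complex) \<Rightarrow> ('a \<times> 'a) set \<Rightarrow>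
   ('a set \<times> ('a \<Rightarrow> 'a \<Rightarrow> complex)) set" where
  "Closures_of_op H ip T = {(D, t). form_closure H ip D t (Domain T) (op_form ip T)}"

definition Completions_of_op ::
  "'a::complex_vector set \<Rightarrow> ('a \<Rightarrow> 'a \<Rightarrow> complex) \<Rightarrow> ('a \<times> 'a) set \<Rightarrow>
   ('a set \<times> ('a \<Rightarrow> 'a \<Rightarrow> complex) \<times> ('a \<times> 'a) set) set" where
  "Completions_of_op H ip T =
     {(K, ipK, A). krein_completion K ipK (Domain T) (op_form ip T) \<and>
        continuously_embedded K ipK H ip \<and> A = op_restrict T (T\<inverse> `` K)}"

end

theory Submission
  imports Defs
begin

text \<open>Write \<open>[\<cdot>,\<cdot>]\<close> for the form \<open>(T\<cdot>,\<cdot>)\<close> on \<open>dom T\<close>. A closure of it with gap point \<open>0\<close> and a Krein space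
completion of \<open>dom T\<close> that is continuously embedded in \<open>H\<close> are the same data, a space \<open>D\<close> with
a form \<open>t\<close>; and \<open>A\<close> is in both descriptions the restriction of \<open>T\<close> to \<open>T\<^sup>-\<^sup>1 D\<close> as soon as the
representing operator of \<open>t\<close> is \<open>T\<close>. Almost everything therefore rests on one question: a
closure comes with some gap point \<open>l\<close>, and one has to know that \<open>0\<close> is then a gap point too
(\<open>gap_point_moves_to_0\<close>).

Fix a Hilbert norm on \<open>D\<close> from the Krein space \<open>(D, t\<^sub>l)\<close> with fundamental symmetry \<open>J\<close>. By density
\<open>t[x,v] = (Tx,v)\<close> for \<open>x \<in> dom T\<close> and \<open>v \<in> D\<close>, and \<open>T\<^sup>-\<^sup>1\<close> is bounded from \<open>H\<close> into \<open>D\<close>. Hence, for every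
\<open>x \<in> D\<close>, the vector \<open>y = Jx - l T\<^sup>-\<^sup>1 Jx\<close> has norm at most \<open>M\<parallel>x\<parallel>\<close> and satisfies
\<open>t[x,y] = t\<^sub>l[x,Jx] + l(x,Jx) - l(x,Jx) = \<parallel>x\<parallel>\<^sup>2\<close>. So \<open>t\<close> is a bounded form on the Hilbert space \<open>D\<close> whose
Gram operator \<open>S\<close> is bounded below. Such a form is a Krein space inner product
(\<open>krein_space_criterion\<close>): with \<open>R = \<bar>S\<bar>\<close> the kernels of \<open>S - R\<close> and \<open>S + R\<close> are the two parts of a
fundamental decomposition. The modulus \<open>R\<close> is the square root of \<open>S\<^sup>2\<close>, obtained by an iteration
which converges geometrically because \<open>S\<close> is bounded below (\<open>sqrt_exists\<close>,
\<open>absolute_value_exists\<close>). The Krein space topologies of \<open>t\<close> and of \<open>t\<^sub>l\<close> agree, whatever fundamental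
symmetries define them: this is a uniform boundedness argument (\<open>norm_le_of_common_form\<close>).

Conversely, let \<open>t\<close> be closed with gap point \<open>0\<close>. The Riesz theorem in the Krein space \<open>D\<close> yields a
representing operator (\<open>representing_operator_exists\<close>). It is unique, as each of two representing
operators is contained in the adjoint of the other. If it equals \<open>T\<close>, then \<open>dom T\<close> is dense in \<open>D\<close>: a
vector \<open>v\<close> orthogonal to it satisfies \<open>(f,Jv) = 0\<close> for all \<open>f\<close> in the range of \<open>T\<close>, which is \<open>H\<close>.
That \<open>A\<close> is J-self-adjoint, J-non-negative and boundedly invertible
(\<open>completion_Krein_triple\<close>) can be read off from \<open>[x,v] = (Tx,v)\<close>; for instance
\<open>[Ax,x] = (Ax,Ax) \<ge> 0\<close>.\<close>

section \<open>Hermitian forms on a subspace\<close>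

definition ip_norm :: "('a \<Rightarrow> 'a \<Rightarrow> complex) \<Rightarrow> 'a \<Rightarrow> real" where
  "ip_norm ip x = sqrt (Re (ip x x))"

locale inner_product =
  fixes V :: "'a::complex_vector set" and ip :: "'a \<Rightarrow> 'a \<Rightarrow> complex"
  assumes space: "inner_product_space V ip"
begin

lemma subspace: "complex_vector.subspace V"
  using space by (simp add: inner_product_space_def)

lemma zero_in [simp, intro]: "0 \<in> V"
  by (rule complex_vector.subspace_0[OF subspace])

lemma add_in [simp, intro]: "x \<in> V \<Longrightarrow> y \<in> V \<Longrightarrow> x + y \<in> V"
  by (rule complex_vector.subspace_add[OF subspace])

lemma diff_in [simp, intro]: "x \<in> V \<Longrightarrow> y \<in> V \<Longrightarrow> x - y \<in> V"
  by (rule complex_vector.subspace_diff[OF subspace])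

lemma scale_in [simp, intro]: "x \<in> V \<Longrightarrow> c *\<^sub>C x \<in> V"
  by (rule complex_vector.subspace_scale[OF subspace])

lemma minus_in [simp, intro]: "x \<in> V \<Longrightarrow> - x \<in> V"
  by (rule complex_vector.subspace_neg[OF subspace])

lemma ip_extensional: "ip \<in> V \<rightarrow>\<^sub>E V \<rightarrow>\<^sub>E UNIV"
  using space unfolding inner_product_space_def hermitian_form_def by blast

lemma ip_add_left: "x \<in> V \<Longrightarrow> y \<in> V \<Longrightarrow> z \<in> V \<Longrightarrow> ip (x + y) z = ip x z + ip y z"
  using space unfolding inner_product_space_def hermitian_form_def by blast

lemma ip_scale_left: "x \<in> V \<Longrightarrow> y \<in> V \<Longrightarrow> ip (c *\<^sub>C x) y = c * ip x y"
  using space unfolding inner_product_space_def hermitian_form_def by blast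

lemma ip_commute: "x \<in> V \<Longrightarrow> y \<in> V \<Longrightarrow> ip y x = cnj (ip x y)"
  using space unfolding inner_product_space_def hermitian_form_def by blast

lemma ip_add_right: "x \<in> V \<Longrightarrow> y \<in> V \<Longrightarrow> z \<in> V \<Longrightarrow> ip x (y + z) = ip x y + ip x z"
  using ip_commute[of "y + z" x] ip_commute[of y x] ip_commute[of z x]
  by (simp add: ip_add_left)

lemma ip_scale_right: "x \<in> V \<Longrightarrow> y \<in> V \<Longrightarrow> ip x (c *\<^sub>C y) = cnj c * ip x y"
  using ip_commute[of "c *\<^sub>C y" x] ip_commute[of y x] by (simp add: ip_scale_left)

lemma ip_zero_left [simp]: "x \<in> V \<Longrightarrow> ip 0 x = 0"
  using ip_add_left[of 0 0 x] by simp

lemma ip_zero_right [simp]: "x \<in> V \<Longrightarrow> ip x 0 = 0"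
  using ip_add_right[of x 0 0] by simp

lemma ip_diff_left: "x \<in> V \<Longrightarrow> y \<in> V \<Longrightarrow> z \<in> V \<Longrightarrow> ip (x - y) z = ip x z - ip y z"
  using ip_add_left[of "x - y" y z] by simp

lemma ip_diff_right: "x \<in> V \<Longrightarrow> y \<in> V \<Longrightarrow> z \<in> V \<Longrightarrow> ip x (y - z) = ip x y - ip x z"
  using ip_add_right[of x "y - z" z] by simp

lemma ip_minus_left: "x \<in> V \<Longrightarrow> y \<in> V \<Longrightarrow> ip (- x) y = - ip x y"
  using ip_diff_left[of 0 x y] by simp

lemma ip_minus_right: "x \<in> V \<Longrightarrow> y \<in> V \<Longrightarrow> ip x (- y) = - ip x y"
  using ip_diff_right[of x 0 y] by simp

lemmas ip_linear = ip_add_left ip_add_right ip_diff_left ip_diff_right ip_scale_left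
  ip_scale_right ip_minus_left ip_minus_right

lemma Im_ip_self: "x \<in> V \<Longrightarrow> Im (ip x x) = 0"
  using ip_commute[of x x] by (simp add: complex_eq_iff)

lemma ip_self_real: "x \<in> V \<Longrightarrow> ip x x = of_real (Re (ip x x))"
  using Im_ip_self[of x] by (simp add: complex_eq_iff)

end

lemma restrict_form_inner_product:
  assumes "inner_product_space V ip" and "complex_vector.subspace W" and "W \<subseteq> V"
  shows "inner_product_space W (\<lambda>x\<in>W. \<lambda>y\<in>W. ip x y)"
    and "inner_product_space W (\<lambda>x\<in>W. \<lambda>y\<in>W. - ip x y)"
proof -
  interpret inner_product V ip by unfold_locales fact
  have W: "x + y \<in> W" "c *\<^sub>C x \<in> W" if "x \<in> W" "y \<in> W" for x y c
    using that assms(2) by (auto intro: complex_vector.subspace_add complex_vector.subspace_scale)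
  have V: "x \<in> V" if "x \<in> W" for x using that assms(3) by blast
  show "inner_product_space W (\<lambda>x\<in>W. \<lambda>y\<in>W. ip x y)"
    unfolding inner_product_space_def hermitian_form_def
  proof (intro conjI ballI allI assms(2))
    fix x y assume "x \<in> W" "y \<in> W"
    then show "(\<lambda>x\<in>W. \<lambda>y\<in>W. ip x y) y x = cnj ((\<lambda>x\<in>W. \<lambda>y\<in>W. ip x y) x y)"
      using ip_commute[of x y] V by simp
  qed (simp_all add: W V ip_linear)
  show "inner_product_space W (\<lambda>x\<in>W. \<lambda>y\<in>W. - ip x y)"
    unfolding inner_product_space_def hermitian_form_def
  proof (intro conjI ballI allI assms(2))
    fix x y assume "x \<in> W" "y \<in> W"
    then show "(\<lambda>x\<in>W. \<lambda>y\<in>W. - ip x y) y x = cnj ((\<lambda>x\<in>W. \<lambda>y\<in>W. - ip x y) x y)"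
      using ip_commute[of x y] V by simp
  qed (simp_all add: W V ip_linear)
qed


section \<open>Hilbert spaces\<close>

lemma null_sandwich:
  fixes f g :: "nat \<Rightarrow> real"
  assumes "g \<longlonglongrightarrow> 0" "\<And>n. f n \<le> g n" "\<And>n. 0 \<le> f n"
  shows "f \<longlonglongrightarrow> 0"
  by (rule Lim_null_comparison[OF always_eventually assms(1)]) (use assms(2,3) in auto)

text \<open>Completeness is split off from positive definiteness, because several spaces below are first seen
to carry a norm, and their completeness is then proved by means of that norm.\<close>

locale pre_hilbert = inner_product +
  assumes ip_self_pos: "x \<in> V \<Longrightarrow> x \<noteq> 0 \<Longrightarrow> 0 < Re (ip x x)"
begin

abbreviation nrm :: "'a \<Rightarrow> real" where "nrm \<equiv> ip_norm ip"

lemma ip_self_nonneg: "x \<in> V \<Longrightarrow> 0 \<le> Re (ip x x)"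
  using ip_self_pos[of x] by (cases "x = 0") auto

lemma nrm_nonneg [simp]: "x \<in> V \<Longrightarrow> 0 \<le> nrm x"
  by (simp add: ip_norm_def ip_self_nonneg)

lemma nrm_power2: "x \<in> V \<Longrightarrow> (nrm x)\<^sup>2 = Re (ip x x)"
  by (simp add: ip_norm_def ip_self_nonneg)

lemma ip_self: "x \<in> V \<Longrightarrow> ip x x = of_real ((nrm x)\<^sup>2)"
  using ip_self_real[of x] by (simp only: nrm_power2)

lemma nrm_eq_0 [simp]: "x \<in> V \<Longrightarrow> nrm x = 0 \<longleftrightarrow> x = 0"
  using ip_self_pos[of x] by (cases "x = 0") (auto simp: ip_norm_def)

lemma nrm_pos: "x \<in> V \<Longrightarrow> x \<noteq> 0 \<Longrightarrow> 0 < nrm x"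
  using ip_self_pos[of x] by (simp add: ip_norm_def)

lemma nrm_zero [simp]: "nrm 0 = 0"
  by simp

lemma nrm_scale: "x \<in> V \<Longrightarrow> nrm (c *\<^sub>C x) = cmod c * nrm x"
proof -
  assume x: "x \<in> V"
  have "ip (c *\<^sub>C x) (c *\<^sub>C x) = c * cnj c * ip x x"
    using x by (simp add: ip_linear)
  also have "\<dots> = of_real ((cmod c)\<^sup>2 * Re (ip x x))"
    using ip_self_real[OF x] complex_norm_square[of c] by simp
  finally have "ip (c *\<^sub>C x) (c *\<^sub>C x) = of_real ((cmod c)\<^sup>2 * Re (ip x x))" .
  then show ?thesis
    by (simp add: ip_norm_def real_sqrt_mult)
qed

lemma nrm_minus: "x \<in> V \<Longrightarrow> nrm (- x) = nrm x"
  by (simp add: ip_norm_def ip_linear)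

lemma nrm_minus_commute: "x \<in> V \<Longrightarrow> y \<in> V \<Longrightarrow> nrm (x - y) = nrm (y - x)"
  using nrm_minus[of "x - y"] by simp

lemma nrm_add_power2:
  "x \<in> V \<Longrightarrow> y \<in> V \<Longrightarrow> (nrm (x + y))\<^sup>2 = (nrm x)\<^sup>2 + 2 * Re (ip x y) + (nrm y)\<^sup>2"
  using ip_commute[of x y] by (simp add: nrm_power2 ip_linear)

lemma nrm_diff_power2:
  "x \<in> V \<Longrightarrow> y \<in> V \<Longrightarrow> (nrm (x - y))\<^sup>2 = (nrm x)\<^sup>2 - 2 * Re (ip x y) + (nrm y)\<^sup>2"
  using ip_commute[of x y] by (simp add: nrm_power2 ip_linear)

lemma nrm_minus_component:
  assumes x: "x \<in> V" and y: "y \<in> V" "y \<noteq> 0"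
  shows "(nrm (x - (ip x y / of_real ((nrm y)\<^sup>2)) *\<^sub>C y))\<^sup>2 = (nrm x)\<^sup>2 - (cmod (ip x y) / nrm y)\<^sup>2"
proof -
  have pos: "nrm y > 0" using y by (simp add: nrm_pos)
  define a where "a = ip x y / of_real ((nrm y)\<^sup>2)"
  have "ip x (a *\<^sub>C y) = of_real ((cmod (ip x y))\<^sup>2 / (nrm y)\<^sup>2)"
    using x y unfolding of_real_divide complex_norm_square by (simp add: ip_linear a_def)
  then have re: "Re (ip x (a *\<^sub>C y)) = (cmod (ip x y) / nrm y)\<^sup>2" by (simp add: power_divide)
  have "cmod a = cmod (ip x y) / (nrm y)\<^sup>2"
    by (simp add: a_def norm_divide norm_power)
  then have "cmod a * nrm y = cmod (ip x y) / nrm y"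
    using pos by (simp add: power2_eq_square)
  then show ?thesis
    unfolding a_def[symmetric] using x y by (simp add: nrm_diff_power2 re nrm_scale)
qed

lemma cauchy_schwarz:
  assumes x: "x \<in> V" and y: "y \<in> V"
  shows "cmod (ip x y) \<le> nrm x * nrm y"
proof (cases "y = 0")
  case False
  then have pos: "nrm y > 0" using y by (simp add: nrm_pos)
  have "(cmod (ip x y) / nrm y)\<^sup>2 \<le> (nrm x)\<^sup>2"
    using nrm_minus_component[OF x y False]
      zero_le_power2[of "nrm (x - (ip x y / of_real ((nrm y)\<^sup>2)) *\<^sub>C y)"] by simp
  then have "cmod (ip x y) / nrm y \<le> nrm x"
    by (rule power2_le_imp_le) (use x in simp)
  then show ?thesis
    using pos by (simp add: field_simps)
qed (use x in simp)

lemma nrm_triangle: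
  assumes "x \<in> V" "y \<in> V"
  shows "nrm (x + y) \<le> nrm x + nrm y"
proof -
  have "Re (ip x y) \<le> nrm x * nrm y"
    using cauchy_schwarz[OF assms] complex_Re_le_cmod order_trans by blast
  then have "(nrm (x + y))\<^sup>2 \<le> (nrm x + nrm y)\<^sup>2"
    using assms by (simp add: nrm_add_power2 power2_sum)
  then show ?thesis
    using assms by (simp add: power2_le_iff_abs_le)
qed

lemma nrm_triangle_diff: "x \<in> V \<Longrightarrow> y \<in> V \<Longrightarrow> nrm (x - y) \<le> nrm x + nrm y"
  using nrm_triangle[of x "- y"] nrm_minus[of y] by simp

lemma nrm_triangle3: "x \<in> V \<Longrightarrow> y \<in> V \<Longrightarrow> z \<in> V \<Longrightarrow> nrm (x - z) \<le> nrm (x - y) + nrm (y - z)"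
  using nrm_triangle[of "x - y" "y - z"] by simp

lemma nrm_le_add_diff: "x \<in> V \<Longrightarrow> y \<in> V \<Longrightarrow> nrm x \<le> nrm y + nrm (x - y)"
  using nrm_triangle[of y "x - y"] by simp

lemma eq_zeroI: "x \<in> V \<Longrightarrow> (\<And>y. y \<in> V \<Longrightarrow> ip x y = 0) \<Longrightarrow> x = 0"
  using ip_self_pos[of x] by fastforce

lemma eqI_ip: "x \<in> V \<Longrightarrow> y \<in> V \<Longrightarrow> (\<And>z. z \<in> V \<Longrightarrow> ip x z = ip y z) \<Longrightarrow> x = y"
  using eq_zeroI[of "x - y"] by (simp add: ip_linear)

lemma ip_dist_nrm: "x \<in> V \<Longrightarrow> y \<in> V \<Longrightarrow> ip_dist V ip x y = nrm (x - y)"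
  by (simp add: ip_dist_def ip_self norm_power)

sublocale metric: Metric_space V "ip_dist V ip"
proof
  show "0 \<le> ip_dist V ip x y" for x y
    by (simp add: ip_dist_def)
  show "ip_dist V ip x y = ip_dist V ip y x" for x y
    using ip_dist_nrm[of x y] ip_dist_nrm[of y x] nrm_minus_commute[of x y]
    by (auto simp: ip_dist_def)
  show "ip_dist V ip x y = 0 \<longleftrightarrow> x = y" if "x \<in> V" "y \<in> V" for x y
    using that by (simp add: ip_dist_nrm)
  show "ip_dist V ip x z \<le> ip_dist V ip x y + ip_dist V ip y z"
    if "x \<in> V" "y \<in> V" "z \<in> V" for x y z
    using that by (simp add: ip_dist_nrm nrm_triangle3)
qed

text \<open>Convergence in norm. Working with real null sequences rather than with the metric topology lets
the limit theorems for real and complex sequences do the work.\<close>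

definition conv :: "(nat \<Rightarrow> 'a) \<Rightarrow> 'a \<Rightarrow> bool" where
  "conv s x \<longleftrightarrow> (\<forall>n. s n \<in> V) \<and> x \<in> V \<and> (\<lambda>n. nrm (s n - x)) \<longlonglongrightarrow> 0"

lemma convD: "conv s x \<Longrightarrow> s n \<in> V" "conv s x \<Longrightarrow> x \<in> V"
  by (auto simp: conv_def)

lemma conv_shift: "conv s x \<Longrightarrow> conv (\<lambda>n. s (Suc n)) x"
  unfolding conv_def using LIMSEQ_Suc by auto

lemma conv_bounded_linear:
  assumes "conv s x" and "f x \<in> V" "\<And>n. f (s n) \<in> V"
    and b: "\<And>n. nrm (f (s n) - f x) \<le> C * nrm (s n - x)"
  shows "conv (\<lambda>n. f (s n)) (f x)"
proof -
  have "(\<lambda>n. C * nrm (s n - x)) \<longlonglongrightarrow> 0"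
    using assms(1) by (auto simp: conv_def intro: tendsto_mult_right_zero)
  then have "(\<lambda>n. nrm (f (s n) - f x)) \<longlonglongrightarrow> 0"
    by (rule null_sandwich) (use assms in \<open>auto simp: conv_def\<close>)
  then show ?thesis using assms by (simp add: conv_def)
qed

lemma conv_add: 
  assumes "conv s x" "conv r y"
  shows "conv (\<lambda>n. s n + r n) (x + y)"
proof -
  have *: "s n \<in> V" "r n \<in> V" "x \<in> V" "y \<in> V" for n using assms by (auto simp: conv_def)
  have "(\<lambda>n. nrm (s n - x) + nrm (r n - y)) \<longlonglongrightarrow> 0"
    using assms by (auto simp: conv_def intro: tendsto_add_zero)
  moreover have "nrm (s n + r n - (x + y)) \<le> nrm (s n - x) + nrm (r n - y)" for n
    using nrm_triangle[of "s n - x" "r n - y"] * by (simp add: algebra_simps)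
  ultimately have "(\<lambda>n. nrm (s n + r n - (x + y))) \<longlonglongrightarrow> 0"
    by (rule null_sandwich) (use * in auto)
  then show ?thesis using * by (simp add: conv_def)
qed

lemma conv_scale: "conv s x \<Longrightarrow> conv (\<lambda>n. c *\<^sub>C s n) (c *\<^sub>C x)"
  by (rule conv_bounded_linear[where C = "cmod c"])
    (auto simp: conv_def nrm_scale complex_vector.scale_right_diff_distrib[symmetric])

lemma conv_const: "x \<in> V \<Longrightarrow> conv (\<lambda>n. x) x"
  by (simp add: conv_def)

lemma conv_unique:
  assumes "conv s x" "conv s y"
  shows "x = y"
proof -
  have *: "s n \<in> V" "x \<in> V" "y \<in> V" for n using assms by (auto simp: conv_def)
  have "(\<lambda>n. nrm (s n - x) + nrm (s n - y)) \<longlonglongrightarrow> 0"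
    using assms by (auto simp: conv_def intro: tendsto_add_zero)
  moreover have "nrm (x - y) \<le> nrm (s n - x) + nrm (s n - y)" for n
    using nrm_triangle3[of x "s n" y] nrm_minus_commute[of x "s n"] * by simp
  ultimately have "nrm (x - y) \<le> 0"
    by (intro LIMSEQ_le_const) auto
  then have "nrm (x - y) = 0" using nrm_nonneg[OF diff_in[OF *(2,3)]] by simp
  then show ?thesis using *(2,3) by simp
qed

lemma conv_functional:
  fixes f :: "'a \<Rightarrow> complex"
  assumes "conv s x" and b: "\<And>n. cmod (f (s n) - f x) \<le> C * nrm (s n - x)"
  shows "(\<lambda>n. f (s n)) \<longlonglongrightarrow> f x"
proof -
  have "(\<lambda>n. C * nrm (s n - x)) \<longlonglongrightarrow> 0"
    using assms(1) by (auto simp: conv_def intro: tendsto_mult_right_zero)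
  then have "(\<lambda>n. f (s n) - f x) \<longlonglongrightarrow> 0"
    by (rule Lim_null_comparison[rotated]) (use b in simp)
  then show ?thesis by (simp add: LIM_zero_iff)
qed

lemma conv_ip_left: "conv s x \<Longrightarrow> y \<in> V \<Longrightarrow> (\<lambda>n. ip (s n) y) \<longlonglongrightarrow> ip x y"
proof (rule conv_functional[where f = "\<lambda>x. ip x y" and C = "nrm y"])
  fix n assume "conv s x" "y \<in> V"
  then show "cmod (ip (s n) y - ip x y) \<le> nrm y * nrm (s n - x)"
    using cauchy_schwarz[of "s n - x" y] convD[of s x] by (simp add: ip_linear mult.commute)
qed auto

lemma conv_ip_right: "conv s x \<Longrightarrow> y \<in> V \<Longrightarrow> (\<lambda>n. ip y (s n)) \<longlonglongrightarrow> ip y x"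
proof (rule conv_functional[where f = "\<lambda>x. ip y x" and C = "nrm y"])
  fix n assume "conv s x" "y \<in> V"
  then show "cmod (ip y (s n) - ip y x) \<le> nrm y * nrm (s n - x)"
    using cauchy_schwarz[of y "s n - x"] convD[of s x] by (simp add: ip_linear mult.commute)
qed auto

lemma conv_nrm:
  assumes "conv s x"
  shows "(\<lambda>n. nrm (s n)) \<longlonglongrightarrow> nrm x"
proof -
  have *: "s n \<in> V" "x \<in> V" for n using assms by (auto simp: conv_def)
  have le: "\<bar>nrm (s n) - nrm x\<bar> \<le> nrm (s n - x)" for n
    using nrm_le_add_diff[of "s n" x] nrm_le_add_diff[of x "s n"] nrm_minus_commute[of x "s n"] *
    by (simp add: abs_le_iff)
  have "(\<lambda>n. nrm (s n - x)) \<longlonglongrightarrow> 0"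
    using assms by (simp add: conv_def)
  then have "(\<lambda>n. \<bar>nrm (s n) - nrm x\<bar>) \<longlonglongrightarrow> 0"
    by (rule null_sandwich[OF _ le]) simp
  then have "(\<lambda>n. nrm (s n) - nrm x) \<longlonglongrightarrow> 0"
    by (rule tendsto_rabs_zero_cancel)
  then show ?thesis by (simp add: LIM_zero_iff)
qed

lemma conv_nrm_le: "conv s x \<Longrightarrow> (\<And>n. nrm (s n) \<le> b) \<Longrightarrow> nrm x \<le> b"
  by (rule LIMSEQ_le_const2[OF conv_nrm]) auto

lemma ip_topology_eq: "ip_topology V ip = metric.mtopology"
  by (simp add: ip_topology_def)

lemma dense_iff:
  assumes "W \<subseteq> V"
  shows "ip_topology V ip closure_of W = V \<longleftrightarrow> (\<forall>x\<in>V. \<forall>e>0. \<exists>w\<in>W. nrm (x - w) < e)"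
proof -
  have "ip_topology V ip closure_of W = {x \<in> V. \<forall>e>0. \<exists>w\<in>W. nrm (x - w) < e}"
    unfolding ip_topology_eq metric.metric_closure_of
    using assms by (auto simp: ip_dist_nrm subset_iff) (metis ip_dist_nrm)
  then show ?thesis by blast
qed

lemma conv_of_approx:
  assumes "x \<in> V" "W \<subseteq> V" "\<And>e. e > 0 \<Longrightarrow> \<exists>w\<in>W. nrm (x - w) < e"
  shows "\<exists>s. (\<forall>n. s n \<in> W) \<and> conv s x"
proof -
  have "\<exists>w\<in>W. nrm (x - w) < inverse (real (Suc n))" for n
    using assms(3) by (meson inverse_positive_iff_positive of_nat_0_less_iff zero_less_Suc)
  then obtain s where s: "\<And>n. s n \<in> W" "\<And>n. nrm (x - s n) < inverse (real (Suc n))"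
    by metis
  have V: "s n \<in> V" for n using s assms(2) by auto
  have "(\<lambda>n. nrm (s n - x)) \<longlonglongrightarrow> 0"
    by (rule null_sandwich[OF LIMSEQ_inverse_real_of_nat])
      (use s V assms(1) in \<open>auto intro!: less_imp_le simp: nrm_minus_commute[of _ x]\<close>)
  then show ?thesis using s V assms(1) by (auto simp: conv_def)
qed

end

locale hilbert = pre_hilbert +
  assumes mcomplete: "metric.mcomplete"
begin

lemma cauchy_convergent:
  assumes s: "\<And>n. s n \<in> V"
    and c: "\<And>e. e > 0 \<Longrightarrow> \<exists>N. \<forall>m\<ge>N. \<forall>n\<ge>N. nrm (s m - s n) < e"
  shows "\<exists>x. conv s x"
proof -
  have "metric.MCauchy s"
    using s c by (auto simp: metric.MCauchy_def ip_dist_nrm)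
  then obtain x where "limitin metric.mtopology s x sequentially"
    using mcomplete by (auto simp: metric.mcomplete_def)
  then have "x \<in> V" "\<And>e. e > 0 \<Longrightarrow> \<forall>\<^sub>F n in sequentially. nrm (s n - x) < e"
    using s by (auto simp: metric.limitin_metric ip_dist_nrm)
  then show ?thesis
    using s by (auto simp: conv_def tendsto_iff intro!: exI[of _ x])
qed

text \<open>The completeness argument behind both iterations below, the one for square roots and the one for
inverses.\<close>

lemma geometric_steps_convergent:
  assumes s: "\<And>n. s n \<in> V" and q: "0 \<le> q" "q < 1"
    and step: "\<And>n. nrm (s (Suc n) - s n) \<le> C * q ^ n"
  shows "\<exists>x. conv s x"
proof (rule cauchy_convergent[OF s])
  have C: "C \<ge> 0" using step[of 0] nrm_nonneg[OF diff_in[OF s[of 1] s[of 0]]] by simp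
  have tail: "nrm (s (n + k) - s n) \<le> C / (1 - q) * (q ^ n - q ^ (n + k))" for n k
  proof (induction k)
    case (Suc k)
    have "nrm (s (n + Suc k) - s n) \<le> C * q ^ (n + k) + C / (1 - q) * (q ^ n - q ^ (n + k))"
      using nrm_triangle3[of "s (Suc (n + k))" "s (n + k)" "s n"] s step[of "n + k"] Suc by simp
    also have "\<dots> = C / (1 - q) * (q ^ n - q ^ (n + Suc k))"
      using q by (simp add: field_simps)
    finally show ?case .
  qed (use s in simp)
  have close: "nrm (s m - s n) \<le> 2 * (C / (1 - q) * q ^ N)" if "m \<ge> N" "n \<ge> N" for m n N
  proof -
    have "nrm (s m - s N) \<le> C / (1 - q) * q ^ N" if "m \<ge> N" for m
    proof -
      have "nrm (s m - s N) \<le> C / (1 - q) * (q ^ N - q ^ m)"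
        using tail[of N "m - N"] that by simp
      also have "\<dots> \<le> C / (1 - q) * q ^ N"
        using q C by (intro mult_left_mono) auto
      finally show ?thesis .
    qed
    from this[OF that(1)] this[OF that(2)]
    show ?thesis
      using nrm_triangle3[of "s m" "s N" "s n"] nrm_minus_commute[of "s N" "s n"] s by simp
  qed
  fix e :: real assume "e > 0"
  have "(\<lambda>N. 2 * (C / (1 - q) * q ^ N)) \<longlonglongrightarrow> 0"
    using q by (intro tendsto_mult_right_zero LIMSEQ_power_zero) simp
  then obtain N where "2 * (C / (1 - q) * q ^ N) < e"
    using order_tendstoD(2)[OF _ \<open>e > 0\<close>] eventually_sequentially by (metis order_refl)
  then show "\<exists>N. \<forall>m\<ge>N. \<forall>n\<ge>N. nrm (s m - s n) < e"
    using close by (meson le_less_trans)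
qed


end

lemma hilbertI: "hilbert_space V ip \<Longrightarrow> hilbert V ip"
proof -
  assume h: "hilbert_space V ip"
  interpret pre_hilbert V ip
    by unfold_locales (use h in \<open>auto simp: hilbert_space_def\<close>)
  show ?thesis
    by unfold_locales (use h in \<open>auto simp: hilbert_space_def\<close>)
qed

lemma (in pre_hilbert) hilbert_spaceI:
  assumes "\<And>s. (\<And>n. s n \<in> V) \<Longrightarrow>
      (\<And>e. e > 0 \<Longrightarrow> \<exists>N. \<forall>m\<ge>N. \<forall>n\<ge>N. nrm (s m - s n) < e) \<Longrightarrow> \<exists>x. conv s x"
  shows "hilbert_space V ip"
proof -
  have "\<exists>x. limitin metric.mtopology s x sequentially" if "metric.MCauchy s" for s
  proof -
    have s: "s n \<in> V" for n using that by (auto simp: metric.MCauchy_def)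
    obtain x where x: "conv s x"
      using assms[of s] s \<open>metric.MCauchy s\<close> by (fastforce simp: metric.MCauchy_def ip_dist_nrm)
    have "\<forall>\<^sub>F n in sequentially. nrm (s n - x) < e" if "e > 0" for e
      by (rule order_tendstoD(2)[OF _ that]) (use x in \<open>simp add: conv_def\<close>)
    then have "limitin metric.mtopology s x sequentially"
      using convD[OF x] by (simp add: metric.limitin_metric ip_dist_nrm)
    then show ?thesis by blast
  qed
  then show ?thesis
    using space ip_self_pos by (simp add: hilbert_space_def metric.mcomplete_def)
qed

context hilbert
begin

lemma conv_diff: "conv s x \<Longrightarrow> conv r y \<Longrightarrow> conv (\<lambda>n. s n - r n) (x - y)"
  using conv_add[of s x "\<lambda>n. (- 1) *\<^sub>C r n" "(- 1) *\<^sub>C y"] conv_scale[of r y "- 1"]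
  by simp

lemma parallelogram:
  "x \<in> V \<Longrightarrow> y \<in> V \<Longrightarrow> (nrm (x + y))\<^sup>2 + (nrm (x - y))\<^sup>2 = 2 * (nrm x)\<^sup>2 + 2 * (nrm y)\<^sup>2"
  by (simp add: nrm_add_power2 nrm_diff_power2)

section \<open>Projections, functionals and uniform boundedness\<close>

text \<open>The projection onto the closure of \<open>W\<close>. A sequence in \<open>W\<close> that minimises the distance to \<open>x\<close> is a
Cauchy sequence by the parallelogram law, and subtracting from \<open>x - z\<close> its component along some
\<open>w \<in> W\<close> could only decrease the minimal distance.\<close>

theorem projection:
  assumes W: "complex_vector.subspace W" "W \<subseteq> V" and x: "x \<in> V"
  shows "\<exists>s z. (\<forall>n. s n \<in> W) \<and> conv s z \<and> (\<forall>w\<in>W. ip (x - z) w = 0)"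
proof -
  have V: "w \<in> V" if "w \<in> W" for w using that W(2) by blast
  have "0 \<in> W" by (rule complex_vector.subspace_0[OF W(1)])
  define d where "d = (INF w\<in>W. (nrm (x - w))\<^sup>2)"
  have bdd: "bdd_below ((\<lambda>w. (nrm (x - w))\<^sup>2) ` W)"
    by (rule bdd_belowI[of _ 0]) auto
  have d_le: "d \<le> (nrm (x - w))\<^sup>2" if "w \<in> W" for w
    unfolding d_def by (rule cINF_lower[OF bdd that])
  have "\<exists>w\<in>W. (nrm (x - w))\<^sup>2 < d + inverse (real (Suc n))" for n
    using cINF_less_iff[OF _ bdd, of "d + inverse (real (Suc n))"] \<open>0 \<in> W\<close>
    by (fastforce simp flip: d_def)
  then obtain s where sW: "\<And>n. s n \<in> W"
    and s: "\<And>n. (nrm (x - s n))\<^sup>2 < d + inverse (real (Suc n))"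
    by metis
  have sV: "s n \<in> V" for n by (rule V[OF sW])
  have close: "(nrm (s m - s n))\<^sup>2 \<le> 4 * inverse (real (Suc N))" if "N \<le> m" "N \<le> n" for m n N
  proof -
    define w where "w = (1/2) *\<^sub>C (s m + s n)"
    have "w \<in> W"
      unfolding w_def
      by (intro complex_vector.subspace_scale complex_vector.subspace_add W sW)
    have "(x - s m) + (x - s n) = 2 *\<^sub>C (x - w)"
      by (simp add: w_def complex_vector.scale_right_diff_distrib scaleC_scaleC scaleC_one
          scaleC_add_left[of 1 1, simplified])
    then have "(nrm ((x - s m) + (x - s n)))\<^sup>2 = 4 * (nrm (x - w))\<^sup>2"
      using x V[OF \<open>w \<in> W\<close>] by (simp add: nrm_scale power_mult_distrib)
    then have "(nrm (s m - s n))\<^sup>2 = 2 * (nrm (x - s m))\<^sup>2 + 2 * (nrm (x - s n))\<^sup>2 - 4 * (nrm (x - w))\<^sup>2"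
      using parallelogram[of "x - s m" "x - s n"] x sV nrm_minus_commute[of "s m" "s n"] by simp
    moreover have "inverse (real (Suc m)) \<le> inverse (real (Suc N))"
      "inverse (real (Suc n)) \<le> inverse (real (Suc N))"
      using that by auto
    ultimately show ?thesis
      using s[of m] s[of n] d_le[OF \<open>w \<in> W\<close>] by argo
  qed
  obtain z where z: "conv s z"
  proof (atomize_elim, rule cauchy_convergent[OF sV])
    fix e :: real assume "e > 0"
    then obtain N where N: "inverse (real (Suc N)) < (e / 2)\<^sup>2"
      using reals_Archimedean[of "(e/2)\<^sup>2"] by auto
    have "nrm (s m - s n) < e" if "N \<le> m" "N \<le> n" for m n
    proof -
      have "(nrm (s m - s n))\<^sup>2 < e\<^sup>2"
        using close[OF that] N by (simp add: power_divide)
      then show ?thesis using \<open>e > 0\<close> by (simp add: power2_less_imp_less)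
    qed
    then show "\<exists>N. \<forall>m\<ge>N. \<forall>n\<ge>N. nrm (s m - s n) < e" by blast
  qed
  have zV: "z \<in> V" using z by (rule convD)
  have lim: "(\<lambda>n. (nrm (x - s n - u))\<^sup>2) \<longlonglongrightarrow> (nrm (x - z - u))\<^sup>2" if "u \<in> V" for u
    by (intro tendsto_power conv_nrm conv_diff conv_const x that z)
  have upper: "(nrm (x - z))\<^sup>2 \<le> d"
  proof (rule LIMSEQ_le)
    show "(\<lambda>n. (nrm (x - s n))\<^sup>2) \<longlonglongrightarrow> (nrm (x - z))\<^sup>2"
      using lim[of 0] by simp
    show "(\<lambda>n. d + inverse (real (Suc n))) \<longlonglongrightarrow> d"
      using tendsto_add[OF tendsto_const LIMSEQ_inverse_real_of_nat, of d] by simp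
  qed (use s less_imp_le in blast)
  have lower: "d \<le> (nrm (x - z - u))\<^sup>2" if "u \<in> W" for u
  proof (rule LIMSEQ_le_const[OF lim[OF V[OF that]]])
    have "d \<le> (nrm (x - s n - u))\<^sup>2" for n
      using d_le[OF complex_vector.subspace_add[OF W(1) sW that], of n] by (simp add: algebra_simps)
    then show "\<exists>N. \<forall>n\<ge>N. d \<le> (nrm (x - s n - u))\<^sup>2" by blast
  qed
  have "ip (x - z) w = 0" if w: "w \<in> W" for w
  proof (cases "w = 0")
    case False
    have pos: "nrm w > 0" using False V[OF w] by (simp add: nrm_pos)
    have "(cmod (ip (x - z) w) / nrm w)\<^sup>2 \<le> 0"
      using nrm_minus_component[of "x - z" w] lower[OF complex_vector.subspace_scale[OF W(1) w]]
        upper x zV V[OF w] False by (smt (verit) diff_in)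
    then show ?thesis using pos by simp
  qed (use x zV in simp)
  then show ?thesis using sW z by blast
qed

text \<open>All density statements about domains of operators reduce to orthogonality by this lemma.\<close>

lemma dense_of_orthogonal_trivial:
  assumes W: "complex_vector.subspace W" "W \<subseteq> V"
    and triv: "\<And>v. v \<in> V \<Longrightarrow> (\<And>w. w \<in> W \<Longrightarrow> ip v w = 0) \<Longrightarrow> v = 0"
  shows "ip_topology V ip closure_of W = V"
  unfolding dense_iff[OF W(2)]
proof (intro ballI allI impI)
  fix x and e :: real assume x: "x \<in> V" and "e > 0"
  obtain s z where s: "\<And>n. s n \<in> W" "conv s z" "\<And>w. w \<in> W \<Longrightarrow> ip (x - z) w = 0"
    using projection[OF W x] by blast
  then have "x - z = 0"
    using x convD(2)[OF s(2)] by (intro triv) auto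
  then have "(\<lambda>n. nrm (s n - x)) \<longlonglongrightarrow> 0"
    using s(2) by (simp add: conv_def)
  then have "\<forall>\<^sub>F n in sequentially. nrm (s n - x) < e"
    using \<open>e > 0\<close> by (rule order_tendstoD)
  then obtain n where "nrm (s n - x) < e"
    by (auto simp: eventually_sequentially)
  then show "\<exists>w\<in>W. nrm (x - w) < e"
    using s(1) nrm_minus_commute[OF x convD(1)[OF s(2)], of n] by (intro bexI[of _ "s n"]) auto
qed

text \<open>The representing vector is a multiple of the component \<open>n\<close> of some \<open>x\<close> with \<open>f x \<noteq> 0\<close> orthogonal to
the kernel of \<open>f\<close>: every \<open>y\<close> differs from a multiple of \<open>n\<close> by an element of the kernel.\<close>

theorem riesz:
  fixes f :: "'a \<Rightarrow> complex"
  assumes add: "\<And>x y. x \<in> V \<Longrightarrow> y \<in> V \<Longrightarrow> f (x + y) = f x + f y"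
    and scale: "\<And>c x. x \<in> V \<Longrightarrow> f (c *\<^sub>C x) = c * f x"
    and bounded: "\<And>x. x \<in> V \<Longrightarrow> cmod (f x) \<le> C * nrm x"
  shows "\<exists>u\<in>V. \<forall>x\<in>V. f x = ip x u"
proof (cases "\<forall>x\<in>V. f x = 0")
  case True
  then show ?thesis by (intro bexI[of _ 0]) auto
next
  case False
  then obtain x where x: "x \<in> V" "f x \<noteq> 0" by blast
  have diff: "f (y - z) = f y - f z" if "y \<in> V" "z \<in> V" for y z
    using add[of "y - z" z] that by simp
  have f0: "f 0 = 0" using add[of 0 0] by simp
  define W where "W = {y \<in> V. f y = 0}"
  have W: "complex_vector.subspace W" "W \<subseteq> V"
    by (auto simp: W_def complex_vector.subspace_def add scale f0)
  obtain s z where s: "\<And>n. s n \<in> W" "conv s z" "\<And>w. w \<in> W \<Longrightarrow> ip (x - z) w = 0"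
    using projection[OF W x(1)] by blast
  have zV: "z \<in> V" by (rule convD[OF s(2)])
  have "(\<lambda>n. f (s n)) \<longlonglongrightarrow> f z"
    using zV convD(1)[OF s(2)]
    by (intro conv_functional[OF s(2), where C = C]) (simp add: bounded flip: diff)
  then have "f z = 0"
    using s(1) by (simp add: W_def LIMSEQ_const_iff)
  define n where "n = x - z"
  have n: "n \<in> V" "f n = f x" "\<And>w. w \<in> W \<Longrightarrow> ip w n = 0"
  proof -
    show n: "n \<in> V" "f n = f x" using x zV \<open>f z = 0\<close> by (auto simp: n_def diff)
    fix w assume "w \<in> W"
    then show "ip w n = 0"
      using s(3)[of w] ip_commute[OF n(1), of w] W(2) by (auto simp: n_def)
  qed
  have pos: "nrm n \<noteq> 0" using n(1,2) x(2) f0 by auto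
  show ?thesis
  proof (intro bexI ballI)
    fix y assume y: "y \<in> V"
    define w where "w = y - (f y / f n) *\<^sub>C n"
    have "w \<in> W" using y n(1,2) x(2) by (simp add: W_def w_def diff scale)
    then have "ip y n = (f y / f n) * of_real ((nrm n)\<^sup>2)"
      using n(3)[of w] y n(1) by (simp add: w_def ip_linear ip_self)
    then show "f y = ip y ((cnj (f n) / of_real ((nrm n)\<^sup>2)) *\<^sub>C n)"
      using y n(1,2) x(2) pos by (simp add: ip_linear)
  qed (use n(1) in simp)
qed

text \<open>By Baire's theorem one of the closed sets on which all functionals are bounded by \<open>n\<close> contains a
ball; by linearity the common bound on that ball gives one on a ball around \<open>0\<close>.\<close>

theorem uniform_boundedness:
  fixes f :: "'i \<Rightarrow> 'a \<Rightarrow> complex"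
  assumes add: "\<And>i x y. i \<in> I \<Longrightarrow> x \<in> V \<Longrightarrow> y \<in> V \<Longrightarrow> f i (x + y) = f i x + f i y"
    and scale: "\<And>i c x. i \<in> I \<Longrightarrow> x \<in> V \<Longrightarrow> f i (c *\<^sub>C x) = c * f i x"
    and bounded: "\<And>i. i \<in> I \<Longrightarrow> \<exists>C. \<forall>x\<in>V. cmod (f i x) \<le> C * nrm x"
    and pointwise: "\<And>x. x \<in> V \<Longrightarrow> \<exists>C. \<forall>i\<in>I. cmod (f i x) \<le> C"
  shows "\<exists>C\<ge>0. \<forall>i\<in>I. \<forall>x\<in>V. cmod (f i x) \<le> C * nrm x"
proof -
  have diff: "f i (y - z) = f i y - f i z" if "y \<in> V" "z \<in> V" "i \<in> I" for y z i
    using add[of i "y - z" z] that by simp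
  define A where "A n = {x \<in> V. \<forall>i\<in>I. cmod (f i x) \<le> real n}" for n
  have closed: "closedin metric.mtopology (A n)" for n
    unfolding metric.closedin_metric
  proof (intro conjI allI impI)
    show "A n \<subseteq> V" by (auto simp: A_def)
    fix x assume "x \<in> V - A n"
    then obtain i where i: "i \<in> I" "cmod (f i x) > real n" and x: "x \<in> V" by (auto simp: A_def)
    obtain C where C: "\<And>x. x \<in> V \<Longrightarrow> cmod (f i x) \<le> C * nrm x" using bounded[OF i(1)] by blast
    define r where "r = (cmod (f i x) - real n) / (\<bar>C\<bar> + 1)"
    have "r > 0" using i by (simp add: r_def)
    moreover have "y \<notin> A n" if "y \<in> metric.mball x r" for y
    proof -
      have y: "y \<in> V" "nrm (x - y) < r" using that x by (auto simp: ip_dist_nrm)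
      have "cmod (f i x) - cmod (f i y) \<le> cmod (f i (x - y))"
        using diff[OF x y(1) i(1)] norm_triangle_ineq2 by simp
      also have "\<dots> \<le> (\<bar>C\<bar> + 1) * nrm (x - y)"
        using C[of "x - y"] x y(1) mult_right_mono[of C "\<bar>C\<bar> + 1" "nrm (x - y)"] by fastforce
      also have "\<dots> < (\<bar>C\<bar> + 1) * r" using y(2) by (intro mult_strict_left_mono) auto
      also have "\<dots> = cmod (f i x) - real n" by (simp add: r_def)
      finally show ?thesis using i(1) by (auto simp: A_def not_le)
    qed
    ultimately show "\<exists>r>0. disjnt (A n) (metric.mball x r)"
      by (auto simp: disjnt_iff)
  qed
  have "\<Union> (range A) = V"
  proof -
    have "\<exists>n. x \<in> A n" if x: "x \<in> V" for x
    proof -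
      obtain C where "\<forall>i\<in>I. cmod (f i x) \<le> C" using pointwise[OF x] by blast
      moreover obtain n where "C \<le> real n" using real_arch_simple by blast
      ultimately have "x \<in> A n" using x by (auto simp: A_def intro: order_trans)
      then show ?thesis ..
    qed
    then show ?thesis by (auto simp: A_def)
  qed
  moreover have "metric.mtopology interior_of V \<noteq> {}"
    using interior_of_topspace[of metric.mtopology] zero_in by auto
  ultimately obtain n where "metric.mtopology interior_of (A n) \<noteq> {}"
    using metric.metric_Baire_category_alt[OF mcomplete, of "range A"] closed by auto
  then obtain x r where "r > 0" and x: "x \<in> V" and ball: "metric.mball x r \<subseteq> A n"
    by (auto simp: ex_in_conv[symmetric] metric.in_interior_of_mball)
  have ball: "cmod (f i v) \<le> 2 * real n" if "v \<in> V" "nrm v < r" "i \<in> I" for v i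
  proof -
    have "x + v \<in> A n" "x \<in> A n"
      using ball that x \<open>r > 0\<close> by (auto simp: ip_dist_nrm nrm_minus subset_iff)
    then have "cmod (f i (x + v)) \<le> real n" "cmod (f i x) \<le> real n"
      using that(3) by (auto simp: A_def)
    moreover have "f i v = f i (x + v) - f i x" using add[of i x v] that x by simp
    ultimately show ?thesis using norm_triangle_ineq4[of "f i (x + v)" "f i x"] by simp
  qed
  have "cmod (f i v) \<le> (4 * real n / r) * nrm v" if v: "v \<in> V" "i \<in> I" for v i
  proof (cases "v = 0")
    case True
    then show ?thesis using diff[of 0 0 i] v by simp
  next
    case False
    then have pos: "nrm v > 0" using v by (simp add: nrm_pos)
    define c where "c = r / (2 * nrm v)"
    have c: "c > 0" using pos \<open>r > 0\<close> by (simp add: c_def)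
    have "nrm (complex_of_real c *\<^sub>C v) < r"
      using v c pos \<open>r > 0\<close> by (simp add: nrm_scale) (simp add: c_def)
    from ball[OF _ this v(2)] have "c * cmod (f i v) \<le> 2 * real n"
      using v c by (simp add: scale norm_mult)
    then show ?thesis using pos \<open>r > 0\<close> by (simp add: c_def field_simps)
  qed
  then show ?thesis using \<open>r > 0\<close> by (intro exI[of _ "4 * real n / r"]) auto
qed

end

section \<open>The modulus of a bounded self-adjoint operator\<close>

context inner_product
begin

definition linear_on :: "('a \<Rightarrow> 'a) \<Rightarrow> bool" where
  "linear_on A \<longleftrightarrow> (\<forall>x\<in>V. A x \<in> V) \<and> (\<forall>x\<in>V. \<forall>y\<in>V. A (x + y) = A x + A y) \<and>
     (\<forall>c. \<forall>x\<in>V. A (c *\<^sub>C x) = c *\<^sub>C A x)"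

lemma linear_onD:
  assumes "linear_on A"
  shows "x \<in> V \<Longrightarrow> A x \<in> V"
    and "x \<in> V \<Longrightarrow> y \<in> V \<Longrightarrow> A (x + y) = A x + A y"
    and "x \<in> V \<Longrightarrow> y \<in> V \<Longrightarrow> A (x - y) = A x - A y"
    and "x \<in> V \<Longrightarrow> A (c *\<^sub>C x) = c *\<^sub>C A x"
    and "A 0 = 0"
proof -
  have add: "A (x + y) = A x + A y" if "x \<in> V" "y \<in> V" for x y
    using assms that by (simp add: linear_on_def)
  show "x \<in> V \<Longrightarrow> A x \<in> V" "x \<in> V \<Longrightarrow> y \<in> V \<Longrightarrow> A (x + y) = A x + A y"
    "x \<in> V \<Longrightarrow> A (c *\<^sub>C x) = c *\<^sub>C A x"
    using assms by (simp_all add: linear_on_def)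
  show "x \<in> V \<Longrightarrow> y \<in> V \<Longrightarrow> A (x - y) = A x - A y"
    using add[of "x - y" y] by simp
  show "A 0 = 0" using add[of 0 0] by simp
qed

end

lemma scaleC_half_add_half: "(1/2) *\<^sub>C x + (1/2) *\<^sub>C x = (x::'a::complex_vector)"
  by (simp add: scaleC_one flip: scaleC_add_left)

text \<open>An iteration for \<open>Y = 1 - (1 - E)\<^sup>1\<^sup>/\<^sup>2\<close>, that is, for the fixed point of \<open>Y = (E + Y\<^sup>2)/2\<close>.\<close>

primrec sqrt_iter :: "('a::complex_vector \<Rightarrow> 'a) \<Rightarrow> nat \<Rightarrow> 'a \<Rightarrow> 'a" where
  "sqrt_iter E 0 x = 0"
| "sqrt_iter E (Suc n) x = (1/2) *\<^sub>C (E x + sqrt_iter E n (sqrt_iter E n x))"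

context hilbert
begin

text \<open>If \<open>\<parallel>E\<parallel> \<le> q < 1\<close>, then every iterate satisfies \<open>\<parallel>Y\<^sub>n\<parallel> \<le> q\<close>, as \<open>(q + q\<^sup>2)/2 \<le> q\<close>; and then
\<open>Y\<^sub>n\<^sub>+\<^sub>1\<^sup>2 - Y\<^sub>n\<^sup>2 = Y\<^sub>n\<^sub>+\<^sub>1(Y\<^sub>n\<^sub>+\<^sub>1 - Y\<^sub>n) + (Y\<^sub>n\<^sub>+\<^sub>1 - Y\<^sub>n)Y\<^sub>n\<close> shows that the steps shrink by the factor \<open>q\<close>. The equation for
the limit \<open>Y\<close> says that \<open>(1 - Y)\<^sup>2 = 1 - E\<close>. The bound \<open>\<parallel>Y\<parallel> \<le> q\<close> makes \<open>1 - Y\<close> uniformly positive, without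
any spectral theory, and \<open>Y\<close> commutes with every bounded operator that commutes with \<open>E\<close>, because the iterates do.\<close>

lemma sqrt_exists:
  assumes E: "linear_on E" and sym: "\<And>x y. x \<in> V \<Longrightarrow> y \<in> V \<Longrightarrow> ip (E x) y = ip x (E y)"
    and q: "0 \<le> q" "q < 1" and contr: "\<And>x. x \<in> V \<Longrightarrow> nrm (E x) \<le> q * nrm x"
  obtains Y where "linear_on Y" and "\<And>x. x \<in> V \<Longrightarrow> nrm (Y x) \<le> q * nrm x"
    and "\<And>x y. x \<in> V \<Longrightarrow> y \<in> V \<Longrightarrow> ip (Y x) y = ip x (Y y)"
    and "\<And>x. x \<in> V \<Longrightarrow> Y x + Y x = E x + Y (Y x)"
    and "\<And>B C x. linear_on B \<Longrightarrow> (\<And>x. x \<in> V \<Longrightarrow> nrm (B x) \<le> C * nrm x) \<Longrightarrow>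
          (\<And>x. x \<in> V \<Longrightarrow> B (E x) = E (B x)) \<Longrightarrow> x \<in> V \<Longrightarrow> B (Y x) = Y (B x)"
proof -
  let ?Y = "sqrt_iter E"
  note EV = linear_onD[OF E]
  have lin: "linear_on (?Y n)" for n
  proof (induction n)
    case 0
    then show ?case by (simp add: linear_on_def)
  next
    case (Suc n)
    note Y = linear_onD[OF Suc]
    show ?case
      using EV Y by (simp add: linear_on_def scaleC_add_right scaleC_scaleC mult.commute algebra_simps)
  qed
  note YV = linear_onD[OF lin]
  have Yq: "nrm (?Y n x) \<le> q * nrm x" if "x \<in> V" for n x
    using that
  proof (induction n arbitrary: x)
    case (Suc n)
    have "nrm (?Y n (?Y n x)) \<le> q * (q * nrm x)"
      using Suc.IH[OF YV(1)[OF Suc.prems], of n] mult_left_mono[OF Suc.IH[OF Suc.prems] q(1)]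
      by linarith
    also have "\<dots> \<le> q * nrm x"
      using q Suc.prems by (intro mult_left_mono) (auto intro: mult_left_le_one_le)
    finally have "nrm (E x + ?Y n (?Y n x)) \<le> 2 * (q * nrm x)"
      using nrm_triangle[of "E x" "?Y n (?Y n x)"] EV(1) YV(1) contr Suc.prems by fastforce
    then show ?case
      using EV(1) YV(1) Suc.prems by (simp add: nrm_scale)
  qed (use q in simp)
  have Ysym: "ip (?Y n x) y = ip x (?Y n y)" if "x \<in> V" "y \<in> V" for n x y
    using that by (induction n arbitrary: x y) (simp_all add: ip_linear EV(1) YV(1) sym)
  have step: "nrm (?Y (Suc n) x - ?Y n x) \<le> nrm x * q ^ n" if "x \<in> V" for n x
    using that
  proof (induction n arbitrary: x)
    case 0
    have "nrm (E x) \<le> nrm x"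
      using contr[OF 0] q nrm_nonneg[OF 0] mult_right_mono[of q 1 "nrm x"] by linarith
    then have "nrm (E x) / 2 \<le> nrm x" using nrm_nonneg[OF 0] by linarith
    then show ?case using EV(1)[OF 0] by (simp add: nrm_scale)
  next
    case (Suc n)
    let ?A = "?Y (Suc n)" and ?B = "?Y n"
    have AB: "?A y \<in> V" "?B y \<in> V" if "y \<in> V" for y using YV(1) that by blast+
    (* A^2 - B^2 = A (A - B) + (A - B) B *)
    have eq: "?Y (Suc (Suc n)) x - ?Y (Suc n) x =
        (1/2) *\<^sub>C (?A (?A x - ?B x) + (?A (?B x) - ?B (?B x)))"
    proof -
      have "?Y (Suc (Suc n)) x - ?Y (Suc n) x = (1/2) *\<^sub>C (?A (?A x) - ?B (?B x))"
        unfolding sqrt_iter.simps(2)[of E "Suc n"] sqrt_iter.simps(2)[of E n x]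
          complex_vector.scale_right_diff_distrib[symmetric]
        by (simp del: sqrt_iter.simps)
      then show ?thesis
        unfolding YV(3)[of "?A x" "?B x" "Suc n", OF AB[OF Suc.prems]]
        by (simp del: sqrt_iter.simps)
    qed
    have "nrm (?A (?A x - ?B x)) \<le> q * (nrm x * q ^ n)"
      using Yq[of "?A x - ?B x" "Suc n"] mult_left_mono[OF Suc.IH[OF Suc.prems] q(1)] AB[OF Suc.prems]
      by (meson diff_in order_trans)
    moreover have "nrm (?A (?B x) - ?B (?B x)) \<le> (q * nrm x) * q ^ n"
      using Suc.IH[OF AB(2)[OF Suc.prems]] mult_right_mono[OF Yq[OF Suc.prems, of n], of "q ^ n"] q
      by simp
    ultimately have "nrm (?A (?A x - ?B x) + (?A (?B x) - ?B (?B x))) \<le> 2 * (nrm x * q ^ Suc n)"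
      using nrm_triangle[of "?A (?A x - ?B x)" "?A (?B x) - ?B (?B x)"] AB Suc.prems
      by (simp add: mult_ac)
    then show ?case
      unfolding eq using AB Suc.prems by (simp add: nrm_scale del: sqrt_iter.simps)
  qed
  have "\<exists>y. conv (\<lambda>n. ?Y n x) y" if "x \<in> V" for x
    by (rule geometric_steps_convergent[OF _ q step[OF that]]) (rule YV(1)[OF that])
  then obtain Y where Y: "\<And>x. x \<in> V \<Longrightarrow> conv (\<lambda>n. ?Y n x) (Y x)"
    by metis
  have YinV: "Y x \<in> V" if "x \<in> V" for x by (rule convD[OF Y[OF that]])
  show ?thesis
  proof
    have "Y (x + y) = Y x + Y y" if "x \<in> V" "y \<in> V" for x y
      by (rule conv_unique[OF Y]) (use conv_add[OF Y Y, of x y] that in \<open>simp_all add: YV\<close>)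
    moreover have "Y (c *\<^sub>C x) = c *\<^sub>C Y x" if "x \<in> V" for x c
      by (rule conv_unique[OF Y]) (use conv_scale[OF Y, of x c] that in \<open>simp_all add: YV\<close>)
    ultimately show linY: "linear_on Y" using YinV by (simp add: linear_on_def)
    show Yle: "nrm (Y x) \<le> q * nrm x" if "x \<in> V" for x
      by (rule conv_nrm_le[OF Y[OF that]]) (rule Yq[OF that])
    show "ip (Y x) y = ip x (Y y)" if "x \<in> V" "y \<in> V" for x y
    proof (rule LIMSEQ_unique)
      show "(\<lambda>n. ip (?Y n x) y) \<longlonglongrightarrow> ip (Y x) y" by (rule conv_ip_left[OF Y]) fact+
      show "(\<lambda>n. ip (?Y n x) y) \<longlonglongrightarrow> ip x (Y y)"
        using conv_ip_right[OF Y, of y x] that by (simp add: Ysym)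
    qed
    show "Y x + Y x = E x + Y (Y x)" if x: "x \<in> V" for x
    proof -
      have "conv (\<lambda>n. ?Y n (?Y n x - Y x)) 0"
      proof -
        have "(\<lambda>n. nrm (?Y n x - Y x)) \<longlonglongrightarrow> 0" using Y[OF x] by (simp add: conv_def)
        then have lim: "(\<lambda>n. q * nrm (?Y n x - Y x)) \<longlonglongrightarrow> 0" by (rule tendsto_mult_right_zero)
        have d: "?Y n x - Y x \<in> V" for n using YV(1) YinV x by blast
        have "(\<lambda>n. nrm (?Y n (?Y n x - Y x))) \<longlonglongrightarrow> 0"
          by (rule null_sandwich[OF lim]) (use Yq[OF d] YV(1)[OF d] in auto)
        then show ?thesis using YV(1)[OF d] by (simp add: conv_def)
      qed
      from conv_add[OF this Y[OF YinV[OF x]]]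
      have "conv (\<lambda>n. ?Y n (?Y n x)) (Y (Y x))"
        using x YV YinV by simp
      then have "conv (\<lambda>n. ?Y (Suc n) x) ((1/2) *\<^sub>C (E x + Y (Y x)))"
        unfolding sqrt_iter.simps(2) by (intro conv_scale conv_add conv_const EV(1) x)
      then have "Y x = (1/2) *\<^sub>C (E x + Y (Y x))"
        using conv_unique conv_shift[OF Y[OF x]] by blast
      then show ?thesis using scaleC_half_add_half[of "E x + Y (Y x)"] by simp
    qed
    fix B :: "'a \<Rightarrow> 'a" and C x
    assume B: "linear_on B" "\<And>x. x \<in> V \<Longrightarrow> nrm (B x) \<le> C * nrm x"
      and comm: "\<And>x. x \<in> V \<Longrightarrow> B (E x) = E (B x)" and x: "x \<in> V"
    note BV = linear_onD[OF B(1)]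
    have "B (?Y n x) = ?Y n (B x)" if "x \<in> V" for n x
      using that by (induction n arbitrary: x) (simp_all add: BV EV(1) YV(1) comm)
    moreover have "conv (\<lambda>n. B (?Y n x)) (B (Y x))"
      by (rule conv_bounded_linear[OF Y[OF x], where C = C])
        (use x in \<open>auto simp: BV YinV YV(1) B(2) simp flip: BV(3)\<close>)
    ultimately show "B (Y x) = Y (B x)"
      using conv_unique Y[OF BV(1)[OF x]] x by simp
  qed
qed

text \<open>Scaling makes \<open>E = 1 - S\<^sup>2/c\<^sup>2\<close> a strict contraction: expanding the square gives
\<open>\<parallel>Ex\<parallel>\<^sup>2 \<le> \<parallel>x\<parallel>\<^sup>2 - \<parallel>Sx\<parallel>\<^sup>2/c\<^sup>2\<close> as \<open>\<parallel>S\<parallel> \<le> c\<close>, and \<open>S\<close> is bounded below. Then \<open>R = c(1 - Y)\<close>, with \<open>Y\<close> from the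
preceding lemma, is the modulus of \<open>S\<close>. It is onto since \<open>z \<mapsto> Yz + x/c\<close> is a contraction.\<close>

lemma absolute_value_exists:
  assumes S: "linear_on S" and sym: "\<And>x y. x \<in> V \<Longrightarrow> y \<in> V \<Longrightarrow> ip (S x) y = ip x (S y)"
    and c: "c > 0" "\<And>x. x \<in> V \<Longrightarrow> nrm (S x) \<le> c * nrm x"
    and M: "M > 0" "\<And>x. x \<in> V \<Longrightarrow> nrm x \<le> M * nrm (S x)"
  obtains R a where "linear_on R" and "\<And>x y. x \<in> V \<Longrightarrow> y \<in> V \<Longrightarrow> ip (R x) y = ip x (R y)"
    and "\<And>x. x \<in> V \<Longrightarrow> R (R x) = S (S x)" and "\<And>x. x \<in> V \<Longrightarrow> S (R x) = R (S x)"
    and "a > 0" and "\<And>x. x \<in> V \<Longrightarrow> a * (nrm x)\<^sup>2 \<le> Re (ip (R x) x)"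
    and "\<And>x. x \<in> V \<Longrightarrow> \<exists>z\<in>V. R z = x"
proof -
  note SV = linear_onD[OF S]
  define k where "k = complex_of_real (1 / c\<^sup>2)"
  define E where "E x = x - k *\<^sub>C S (S x)" for x
  (* The maximum with 0 matters only for the zero space, where c and M may be too small. *)
  define q where "q = sqrt (max 0 (1 - 1 / (M * c)\<^sup>2))"
  have q: "0 \<le> q" "q < 1" using c(1) M(1) by (auto simp: q_def max_def)
  have E: "linear_on E"
    using SV by (simp add: linear_on_def E_def scaleC_add_right complex_vector.scale_right_diff_distrib
        scaleC_scaleC mult.commute)
  have Esym: "ip (E x) y = ip x (E y)" if "x \<in> V" "y \<in> V" for x y
    using that by (simp add: E_def ip_linear SV(1) sym k_def)
  have Eq: "nrm (E x) \<le> q * nrm x" if x: "x \<in> V" for x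
  proof (rule power2_le_imp_le)
    have ck: "cmod k = 1 / c\<^sup>2" by (simp add: k_def norm_divide norm_power)
    have kS: "(nrm (k *\<^sub>C S (S x)))\<^sup>2 \<le> (nrm (S x))\<^sup>2 / c\<^sup>2"
    proof -
      have "(nrm (k *\<^sub>C S (S x)))\<^sup>2 = (nrm (S (S x)))\<^sup>2 / c ^ 4"
        using x SV(1) by (simp add: nrm_scale ck power_mult_distrib power_divide)
      also have "\<dots> \<le> (c * nrm (S x))\<^sup>2 / c ^ 4"
        using x SV(1) c by (intro divide_right_mono power_mono) auto
      also have "\<dots> = (nrm (S x))\<^sup>2 / c\<^sup>2"
        using c(1) by (simp add: power_mult_distrib field_simps power_numeral_reduce)
      finally show ?thesis .
    qed
    have ip: "Re (ip x (k *\<^sub>C S (S x))) = (nrm (S x))\<^sup>2 / c\<^sup>2"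
      using x SV(1) by (simp add: ip_linear k_def ip_self flip: sym)
    have lower: "(nrm x)\<^sup>2 / (M * c)\<^sup>2 \<le> (nrm (S x))\<^sup>2 / c\<^sup>2"
    proof -
      have "(nrm x)\<^sup>2 \<le> M\<^sup>2 * (nrm (S x))\<^sup>2"
        using power_mono[OF M(2)[OF x], of 2] x by (simp add: power_mult_distrib)
      then show ?thesis using M(1) c(1) by (simp add: field_simps power_mult_distrib)
    qed
    have "(nrm (E x))\<^sup>2 = (nrm x)\<^sup>2 - 2 * ((nrm (S x))\<^sup>2 / c\<^sup>2) + (nrm (k *\<^sub>C S (S x)))\<^sup>2"
      using x SV(1) by (simp add: E_def nrm_diff_power2 ip)
    also have "\<dots> \<le> (nrm x)\<^sup>2 - (nrm x)\<^sup>2 / (M * c)\<^sup>2"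
      using kS lower by linarith
    also have "\<dots> = (1 - 1 / (M * c)\<^sup>2) * (nrm x)\<^sup>2" by (simp add: algebra_simps)
    also have "\<dots> \<le> q\<^sup>2 * (nrm x)\<^sup>2"
      by (intro mult_right_mono) (auto simp: q_def)
    finally show "(nrm (E x))\<^sup>2 \<le> (q * nrm x)\<^sup>2" by (simp add: power_mult_distrib)
    show "0 \<le> q * nrm x" using q x by simp
  qed
  obtain Y where Y: "linear_on Y" "\<And>x. x \<in> V \<Longrightarrow> nrm (Y x) \<le> q * nrm x"
    "\<And>x y. x \<in> V \<Longrightarrow> y \<in> V \<Longrightarrow> ip (Y x) y = ip x (Y y)"
    "\<And>x. x \<in> V \<Longrightarrow> Y x + Y x = E x + Y (Y x)"
    "\<And>B C x. linear_on B \<Longrightarrow> (\<And>x. x \<in> V \<Longrightarrow> nrm (B x) \<le> C * nrm x) \<Longrightarrow>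
          (\<And>x. x \<in> V \<Longrightarrow> B (E x) = E (B x)) \<Longrightarrow> x \<in> V \<Longrightarrow> B (Y x) = Y (B x)"
    by (rule sqrt_exists[OF E Esym q Eq]) blast+
  note YV = linear_onD[OF Y(1)]
  define R where "R x = complex_of_real c *\<^sub>C (x - Y x)" for x
  have R: "linear_on R"
    using YV by (simp add: linear_on_def R_def scaleC_add_right complex_vector.scale_right_diff_distrib
        scaleC_scaleC mult.commute)
  note RV = linear_onD[OF R]
  show ?thesis
  proof
    show "linear_on R" by (rule R)
    show "ip (R x) y = ip x (R y)" if "x \<in> V" "y \<in> V" for x y
      using that by (simp add: R_def ip_linear YV(1) Y(3))
    show "R (R x) = S (S x)" if x: "x \<in> V" for x
    proof -
      have "R (R x) = complex_of_real (c\<^sup>2) *\<^sub>C ((x - Y x) - Y (x - Y x))"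
        using x YV by (simp add: R_def scaleC_scaleC complex_vector.scale_right_diff_distrib
            power2_eq_square)
      also have "(x - Y x) - Y (x - Y x) = x - (Y x + Y x) + Y (Y x)"
        using x YV by simp
      also have "\<dots> = k *\<^sub>C S (S x)"
        unfolding Y(4)[OF x] by (simp add: E_def)
      also have "complex_of_real (c\<^sup>2) *\<^sub>C \<dots> = S (S x)"
        using c(1) by (simp add: scaleC_scaleC k_def scaleC_one)
      finally show ?thesis .
    qed
    show "S (R x) = R (S x)" if x: "x \<in> V" for x
    proof -
      have "S (E x) = E (S x)" if "x \<in> V" for x
        using that SV by (simp add: E_def)
      then have "S (Y x) = Y (S x)"
        using Y(5)[OF S c(2) _ x] by blast
      then show ?thesis using x SV YV(1) by (simp add: R_def)
    qed
    show "c * (1 - q) > 0" using c q by simp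
    show "c * (1 - q) * (nrm x)\<^sup>2 \<le> Re (ip (R x) x)" if x: "x \<in> V" for x
    proof -
      have "Re (ip (Y x) x) \<le> nrm (Y x) * nrm x"
        using cauchy_schwarz[OF YV(1)[OF x] x] complex_Re_le_cmod order_trans by blast
      also have "\<dots> \<le> q * (nrm x)\<^sup>2"
        using mult_right_mono[OF Y(2)[OF x] nrm_nonneg[OF x]] by (simp add: power2_eq_square)
      finally have "(1 - q) * (nrm x)\<^sup>2 \<le> Re (ip (x - Y x) x)"
        using x YV(1) by (simp add: ip_linear ip_self algebra_simps)
      then show ?thesis
        using mult_left_mono[of _ _ c] c(1) x YV(1) by (simp add: R_def ip_linear mult.assoc)
    qed
    show "\<exists>z\<in>V. R z = x" if x: "x \<in> V" for x
    proof -
      define b where "b = complex_of_real (1 / c) *\<^sub>C x"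
      define z where "z = rec_nat 0 (\<lambda>_ z. Y z + b)"
      have z_simps: "z 0 = 0" "z (Suc n) = Y (z n) + b" for n by (simp_all add: z_def)
      have b: "b \<in> V" using x by (simp add: b_def)
      have zV: "z n \<in> V" for n by (induction n) (simp_all add: z_simps YV(1) b)
      have "nrm (z (Suc n) - z n) \<le> nrm b * q ^ n" for n
      proof (induction n)
        case (Suc n)
        have "z (Suc (Suc n)) - z (Suc n) = Y (z (Suc n) - z n)"
          using YV(3)[OF zV zV, of "Suc n" n] by (simp add: z_simps)
        then have "nrm (z (Suc (Suc n)) - z (Suc n)) \<le> q * nrm (z (Suc n) - z n)"
          using Y(2)[OF diff_in[OF zV zV], of "Suc n" n] by simp
        also have "\<dots> \<le> q * (nrm b * q ^ n)" by (intro mult_left_mono Suc q)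
        finally show ?case by (simp add: mult_ac)
      qed (simp add: z_simps YV)
      then obtain w where w: "conv z w"
        using geometric_steps_convergent[of z, OF zV q] by blast
      have wV: "w \<in> V" by (rule convD[OF w])
      have "conv (\<lambda>n. Y (z n)) (Y w)"
        by (rule conv_bounded_linear[OF w])
          (use wV zV Y(2) in \<open>auto simp: YV simp flip: YV(3)\<close>)
      then have "conv (\<lambda>n. z (Suc n)) (Y w + b)"
        unfolding z_simps by (intro conv_add conv_const b)
      then have "w = Y w + b" using conv_shift[OF w] conv_unique by blast
      then have "w - Y w = b" by (simp add: algebra_simps)
      then have "R w = x" using c(1) by (simp add: R_def b_def scaleC_scaleC scaleC_one)
      then show ?thesis using wV by blast
    qed
  qed
qed

text \<open>Used for the two parts of a fundamental decomposition, on which the indefinite form or its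
negative induces a norm equivalent to the given one.\<close>

lemma closed_subspace_hilbert:
  assumes g: "inner_product_space W g" and WV: "W \<subseteq> V"
    and closed: "\<And>s x. (\<And>n. s n \<in> W) \<Longrightarrow> conv s x \<Longrightarrow> x \<in> W"
    and a: "a > 0" "\<And>x. x \<in> W \<Longrightarrow> a * (nrm x)\<^sup>2 \<le> Re (g x x)"
    and b: "\<And>x. x \<in> W \<Longrightarrow> Re (g x x) \<le> b * (nrm x)\<^sup>2"
  shows "hilbert_space W g"
proof -
  have W: "x \<in> V" if "x \<in> W" for x using that WV by blast
  interpret W: inner_product W g by unfold_locales (rule g)
  interpret W: pre_hilbert W g
  proof
    fix x assume x: "x \<in> W" "x \<noteq> 0"
    then have "0 < a * (nrm x)\<^sup>2" using a(1) W by simp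
    then show "0 < Re (g x x)" using a(2)[OF x(1)] by linarith
  qed
  have le: "sqrt a * nrm x \<le> W.nrm x" if "x \<in> W" for x
    using real_sqrt_le_mono[OF a(2)[OF that]] W[OF that] by (simp add: ip_norm_def[of g] real_sqrt_mult)
  have ge: "W.nrm x \<le> sqrt \<bar>b\<bar> * nrm x" if "x \<in> W" for x
  proof -
    have "Re (g x x) \<le> \<bar>b\<bar> * (nrm x)\<^sup>2"
      using b[OF that] mult_right_mono[of b "\<bar>b\<bar>" "(nrm x)\<^sup>2"] by fastforce
    from real_sqrt_le_mono[OF this] show ?thesis
      using W[OF that] by (simp add: ip_norm_def[of g] real_sqrt_mult)
  qed
  show ?thesis
  proof (rule W.hilbert_spaceI)
    fix s :: "nat \<Rightarrow> 'a"
    assume s: "\<And>n. s n \<in> W"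
      and cauchy: "\<And>e. e > 0 \<Longrightarrow> \<exists>N. \<forall>m\<ge>N. \<forall>n\<ge>N. W.nrm (s m - s n) < e"
    have "\<exists>N. \<forall>m\<ge>N. \<forall>n\<ge>N. nrm (s m - s n) < e" if "e > 0" for e
    proof -
      obtain N where "\<forall>m\<ge>N. \<forall>n\<ge>N. W.nrm (s m - s n) < sqrt a * e"
        using cauchy[of "sqrt a * e"] a(1) \<open>e > 0\<close> by auto
      moreover have "sqrt a * nrm (s m - s n) \<le> W.nrm (s m - s n)" for m n
        by (intro le W.diff_in s)
      ultimately have "\<forall>m\<ge>N. \<forall>n\<ge>N. sqrt a * nrm (s m - s n) < sqrt a * e"
        by (meson le_less_trans)
      then show ?thesis using a(1) by auto
    qed
    then obtain x where x: "conv s x" using cauchy_convergent[of s] s W by blast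
    have "x \<in> W" by (rule closed[OF s x])
    have "(\<lambda>n. sqrt \<bar>b\<bar> * nrm (s n - x)) \<longlonglongrightarrow> 0"
      using x by (auto simp: conv_def intro: tendsto_mult_right_zero)
    then have "(\<lambda>n. W.nrm (s n - x)) \<longlonglongrightarrow> 0"
      by (rule null_sandwich) (use ge s \<open>x \<in> W\<close> in auto)
    then have "W.conv s x" using s \<open>x \<in> W\<close> by (simp add: W.conv_def)
    then show "\<exists>x. W.conv s x" ..
  qed
qed

section \<open>Forms that make a Hilbert space a Krein space\<close>

definition bounded_form :: "('a \<Rightarrow> 'a \<Rightarrow> complex) \<Rightarrow> bool" where
  "bounded_form t \<longleftrightarrow> (\<exists>c. \<forall>x\<in>V. \<forall>y\<in>V. cmod (t x y) \<le> c * nrm x * nrm y)"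

text \<open>Up to the value of \<open>M\<close> this says that the Gram operator of a bounded hermitian form \<open>t\<close> is bounded
below, hence boundedly invertible. Phrased with a test vector \<open>y\<close> for every \<open>x\<close>, the condition
needs no operator, and in the applications \<open>y\<close> can be written down.\<close>

definition inf_sup_form :: "('a \<Rightarrow> 'a \<Rightarrow> complex) \<Rightarrow> bool" where
  "inf_sup_form t \<longleftrightarrow> (\<exists>M. \<forall>x\<in>V. \<exists>y\<in>V. nrm y \<le> M * nrm x \<and> t x y = of_real ((nrm x)\<^sup>2))"

lemma gram_operator:
  assumes t: "inner_product_space V t"
    and c: "\<And>x y. x \<in> V \<Longrightarrow> y \<in> V \<Longrightarrow> cmod (t x y) \<le> c * nrm x * nrm y"
  obtains S where "linear_on S" "\<And>x y. x \<in> V \<Longrightarrow> y \<in> V \<Longrightarrow> t x y = ip (S x) y"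
    "\<And>x y. x \<in> V \<Longrightarrow> y \<in> V \<Longrightarrow> ip (S x) y = ip x (S y)"
    "\<And>x. x \<in> V \<Longrightarrow> nrm (S x) \<le> c * nrm x"
proof -
  interpret t: inner_product V t by unfold_locales (rule t)
  have "\<exists>u\<in>V. \<forall>y\<in>V. t y x = ip y u" if x: "x \<in> V" for x
    by (rule riesz[where C = "c * nrm x"]) (use x c[OF _ x] in \<open>auto simp: t.ip_linear mult_ac\<close>)
  then obtain S where S: "\<And>x. x \<in> V \<Longrightarrow> S x \<in> V" "\<And>x y. x \<in> V \<Longrightarrow> y \<in> V \<Longrightarrow> t y x = ip y (S x)"
    by metis
  have tS: "t x y = ip (S x) y" if "x \<in> V" "y \<in> V" for x y
    using t.ip_commute[of y x] ip_commute[of y "S x"] S that by simp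
  have "linear_on S"
    unfolding linear_on_def
  proof (intro conjI ballI allI S(1))
    show "S (x + y) = S x + S y" if "x \<in> V" "y \<in> V" for x y
      by (rule eqI_ip) (use that in \<open>simp_all add: S(1) ip_linear t.ip_linear flip: tS\<close>)
    show "S (k *\<^sub>C x) = k *\<^sub>C S x" if "x \<in> V" for k x
      by (rule eqI_ip) (use that in \<open>simp_all add: S(1) ip_linear t.ip_linear flip: tS\<close>)
  qed
  moreover have "nrm (S x) \<le> c * nrm x" if x: "x \<in> V" for x
  proof (cases "nrm (S x) = 0")
    case True
    have "0 \<le> c * nrm x * nrm x" by (rule order_trans[OF norm_ge_zero c[OF x x]])
    then show ?thesis using True x S(1) by (cases "x = 0") (auto simp: zero_le_mult_iff)
  next
    case False
    have "(nrm (S x))\<^sup>2 = cmod (t x (S x))"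
      using x S(1) by (simp add: tS ip_self norm_power)
    also have "\<dots> \<le> c * nrm x * nrm (S x)" by (intro c x S(1))
    finally show ?thesis
      using False nrm_nonneg[OF S(1)[OF x]] by (simp add: power2_eq_square)
  qed
  moreover have "ip (S x) y = ip x (S y)" if "x \<in> V" "y \<in> V" for x y
    using tS[OF that] S(2)[OF that(2,1)] by simp
  ultimately show ?thesis using that[of S] tS by blast
qed

text \<open>Let \<open>S\<close> be the Gram operator and \<open>R\<close> its modulus. Since \<open>R\<^sup>2 = S\<^sup>2\<close> and \<open>RS = SR\<close>, the operators \<open>R + S\<close> and
\<open>R - S\<close> map into the kernels \<open>Vp\<close> of \<open>S - R\<close> and \<open>Vm\<close> of \<open>S + R\<close>; as \<open>x = Rz\<close> for some \<open>z\<close>, these kernels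
span the space. On them \<open>t\<close> coincides with \<open>(R\<cdot>,\<cdot>)\<close> and \<open>-(R\<cdot>,\<cdot>)\<close>, which are uniformly definite, and
symmetry of \<open>R\<close> and \<open>S\<close> makes them orthogonal.\<close>

theorem krein_space_criterion:
  assumes t: "inner_product_space V t" and "bounded_form t" and "inf_sup_form t"
  shows "krein_space V t"
proof -
  interpret t: inner_product V t by unfold_locales (rule t)
  obtain c0 where c0: "\<And>x y. x \<in> V \<Longrightarrow> y \<in> V \<Longrightarrow> cmod (t x y) \<le> c0 * nrm x * nrm y"
    using assms(2) by (auto simp: bounded_form_def)
  define c where "c = \<bar>c0\<bar> + 1"
  have c: "c > 0" "cmod (t x y) \<le> c * nrm x * nrm y" if "x \<in> V" "y \<in> V" for x y
  proof -
    show "c > 0" by (simp add: c_def)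
    have "c0 * (nrm x * nrm y) \<le> c * (nrm x * nrm y)"
      using that by (intro mult_right_mono) (auto simp: c_def)
    then show "cmod (t x y) \<le> c * nrm x * nrm y" using c0[OF that] by simp
  qed
  obtain M0 where M0: "\<And>x. x \<in> V \<Longrightarrow> \<exists>y\<in>V. nrm y \<le> M0 * nrm x \<and> t x y = of_real ((nrm x)\<^sup>2)"
    using assms(3) by (auto simp: inf_sup_form_def)
  define M where "M = \<bar>M0\<bar> + 1"
  obtain S where S: "linear_on S" "\<And>x y. x \<in> V \<Longrightarrow> y \<in> V \<Longrightarrow> t x y = ip (S x) y"
    "\<And>x y. x \<in> V \<Longrightarrow> y \<in> V \<Longrightarrow> ip (S x) y = ip x (S y)" "\<And>x. x \<in> V \<Longrightarrow> nrm (S x) \<le> c * nrm x"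
    by (rule gram_operator[OF t c(2)]) blast+
  note SV = linear_onD[OF S(1)]
  have M: "M > 0" "nrm x \<le> M * nrm (S x)" if x: "x \<in> V" for x
  proof -
    show "M > 0" by (simp add: M_def)
    obtain y where y: "y \<in> V" "nrm y \<le> M0 * nrm x" "t x y = of_real ((nrm x)\<^sup>2)"
      using M0[OF x] by blast
    have "M0 * nrm x \<le> M * nrm x"
      by (intro mult_right_mono) (use x in \<open>auto simp: M_def\<close>)
    then have "nrm y \<le> M * nrm x"
      using y(2) by simp
    moreover have "(nrm x)\<^sup>2 \<le> nrm (S x) * nrm y"
      using cauchy_schwarz[OF SV(1)[OF x] y(1)] y(3) S(2)[OF x y(1)] by (simp add: norm_power)
    ultimately have "(nrm x)\<^sup>2 \<le> nrm (S x) * (M * nrm x)"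
      using mult_left_mono[of "nrm y" "M * nrm x" "nrm (S x)"] SV(1)[OF x] by simp
    then have "nrm x * nrm x \<le> (M * nrm (S x)) * nrm x"
      by (simp add: power2_eq_square mult_ac)
    then show "nrm x \<le> M * nrm (S x)"
      using x nrm_pos[OF x] by (cases "x = 0") (simp_all add: SV(5))
  qed
  obtain R a where R: "linear_on R" "\<And>x y. x \<in> V \<Longrightarrow> y \<in> V \<Longrightarrow> ip (R x) y = ip x (R y)"
    "\<And>x. x \<in> V \<Longrightarrow> R (R x) = S (S x)" "\<And>x. x \<in> V \<Longrightarrow> S (R x) = R (S x)"
    "a > 0" "\<And>x. x \<in> V \<Longrightarrow> a * (nrm x)\<^sup>2 \<le> Re (ip (R x) x)"
    "\<And>x. x \<in> V \<Longrightarrow> \<exists>z\<in>V. R z = x"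
    by (rule absolute_value_exists[OF S(1) S(3) c(1)[OF zero_in zero_in] S(4) M(1)[OF zero_in] M(2)])
      blast+
  note RV = linear_onD[OF R(1)]
  define Vp where "Vp = {x \<in> V. S x = R x}"
  define Vm where "Vm = {x \<in> V. S x = - R x}"
  have sub: "Vp \<subseteq> V" "Vm \<subseteq> V" by (auto simp: Vp_def Vm_def)
  have subspaces: "complex_vector.subspace Vp" "complex_vector.subspace Vm"
    using SV RV by (auto simp: Vp_def Vm_def complex_vector.subspace_def scaleC_add_right)
  have upper: "\<bar>Re (t x x)\<bar> \<le> c * (nrm x)\<^sup>2" if "x \<in> V" for x
    using c(2)[OF that that] abs_Re_le_cmod[of "t x x"] by (simp add: power2_eq_square mult.assoc)
  have lim: "ip (S x) y = k * ip (R x) y"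
    if s: "\<And>n. s n \<in> V" "conv s x" "\<And>n. S (s n) = k *\<^sub>C R (s n)" and y: "y \<in> V" for s x k y
  proof (rule LIMSEQ_unique)
    have x: "x \<in> V" by (rule convD[OF s(2)])
    show "(\<lambda>n. ip (S (s n)) y) \<longlonglongrightarrow> ip (S x) y"
      using conv_ip_left[OF s(2) SV(1)[OF y]] s(1) x y by (simp add: S(3))
    have "(\<lambda>n. k * ip (R (s n)) y) \<longlonglongrightarrow> k * ip (R x) y"
      using tendsto_mult_left[OF conv_ip_left[OF s(2) RV(1)[OF y]], of k] s(1) x y by (simp add: R(2))
    then show "(\<lambda>n. ip (S (s n)) y) \<longlonglongrightarrow> k * ip (R x) y"
      using s(1) y RV(1) by (simp add: s(3) ip_linear)
  qed
  have closed: "x \<in> Vp" if "\<And>n. s n \<in> Vp" "conv s x" for s x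
    using that lim[of s x 1] convD[OF that(2)] SV(1) RV(1)
    by (auto simp: Vp_def scaleC_one intro!: eqI_ip)
  have closed': "x \<in> Vm" if "\<And>n. s n \<in> Vm" "conv s x" for s x
    using that lim[of s x "- 1"] convD[OF that(2)] SV(1) RV(1)
    by (auto simp: Vm_def ip_linear intro!: eqI_ip)
  have "hilbert_space Vp (\<lambda>x\<in>Vp. \<lambda>y\<in>Vp. t x y)"
  proof (rule closed_subspace_hilbert[OF _ sub(1) closed R(5), where b = c])
    show "inner_product_space Vp (\<lambda>x\<in>Vp. \<lambda>y\<in>Vp. t x y)"
      by (rule restrict_form_inner_product[OF t subspaces(1) sub(1)])
    fix x assume x: "x \<in> Vp"
    then show "a * (nrm x)\<^sup>2 \<le> Re ((\<lambda>x\<in>Vp. \<lambda>y\<in>Vp. t x y) x x)"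
      "Re ((\<lambda>x\<in>Vp. \<lambda>y\<in>Vp. t x y) x x) \<le> c * (nrm x)\<^sup>2"
      using R(6)[of x] S(2)[of x x] upper[of x] by (simp_all add: Vp_def)
  qed
  moreover have "hilbert_space Vm (\<lambda>x\<in>Vm. \<lambda>y\<in>Vm. - t x y)"
  proof (rule closed_subspace_hilbert[OF _ sub(2) closed' R(5), where b = c])
    show "inner_product_space Vm (\<lambda>x\<in>Vm. \<lambda>y\<in>Vm. - t x y)"
      by (rule restrict_form_inner_product[OF t subspaces(2) sub(2)])
    fix x assume x: "x \<in> Vm"
    then show "a * (nrm x)\<^sup>2 \<le> Re ((\<lambda>x\<in>Vm. \<lambda>y\<in>Vm. - t x y) x x)"
      "Re ((\<lambda>x\<in>Vm. \<lambda>y\<in>Vm. - t x y) x x) \<le> c * (nrm x)\<^sup>2"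
      using R(6)[of x] S(2)[of x x] upper[of x] RV(1)[of x]
      by (simp_all add: Vm_def ip_linear)
  qed
  moreover have orth: "t x y = 0" if "x \<in> Vp" "y \<in> Vm" for x y
  proof -
    have xy: "x \<in> V" "y \<in> V" "S x = R x" "S y = - R y" using that by (auto simp: Vp_def Vm_def)
    have "ip (R x) y = - ip (R x) y"
      using S(3)[OF xy(1,2)] R(2)[OF xy(1,2)] xy RV(1) by (simp add: ip_linear)
    then show ?thesis using S(2)[OF xy(1,2)] xy by simp
  qed
  moreover have "Vp \<inter> Vm = {0}"
  proof -
    have "x = 0" if "x \<in> Vp" "x \<in> Vm" for x
    proof -
      have "x \<in> V" using that sub by blast
      have "a * (nrm x)\<^sup>2 \<le> 0"
        using R(6)[OF \<open>x \<in> V\<close>] orth[OF that] S(2)[of x x] that by (simp add: Vp_def)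
      then show ?thesis using R(5) \<open>x \<in> V\<close> by (simp add: mult_le_0_iff)
    qed
    then show ?thesis using complex_vector.subspace_0 subspaces by blast
  qed
  moreover have "V = {x + y | x y. x \<in> Vp \<and> y \<in> Vm}"
  proof -
    have "\<exists>p\<in>Vp. \<exists>m\<in>Vm. x = p + m" if x: "x \<in> V" for x
    proof -
      obtain z where z: "z \<in> V" "R z = x" using R(7)[OF x] by blast
      define p m where "p = (1/2) *\<^sub>C (R z + S z)" and "m = (1/2) *\<^sub>C (R z - S z)"
      have "p \<in> Vp"
        using z(1) SV RV by (simp add: Vp_def p_def R(3,4) add.commute)
      moreover have "m \<in> Vm"
        using z(1) SV RV by (simp add: Vm_def m_def R(3,4) flip: complex_vector.scale_minus_right)
      moreover have "p + m = x"
        unfolding z(2)[symmetric] p_def m_def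
        using scaleC_half_add_half[of "R z"] by (simp flip: scaleC_add_right)
      ultimately show ?thesis by blast
    qed
    then show ?thesis using sub by blast
  qed
  ultimately have "fundamental_decomposition V t Vp Vm"
    using sub by (simp add: fundamental_decomposition_def)
  then show ?thesis
    using t by (auto simp: krein_space_def)
qed

end

section \<open>Krein spaces\<close>

text \<open>The Hilbert norm of a Krein space depends on a choice of fundamental symmetry, but two norms for
which the same form \<open>t\<close> is bounded can be compared if, for the first one, \<open>t\<close> has test vectors. The functionals \<open>t[\<cdot>,y]\<close> with \<open>\<parallel>y\<parallel>\<^sub>2 \<le> 1\<close> are bounded
for the first norm, and pointwise bounded since \<open>t\<close> is bounded for the second one; so
\<open>\<bar>t[x,y]\<bar> \<le> C \<parallel>x\<parallel>\<^sub>1 \<parallel>y\<parallel>\<^sub>2\<close>, and a test vector \<open>x\<close> for \<open>y\<close> gives \<open>\<parallel>y\<parallel>\<^sub>1 \<le> C M \<parallel>y\<parallel>\<^sub>2\<close>.\<close>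

lemma norm_le_of_common_form:
  assumes 1: "hilbert V ip1" and 2: "hilbert V ip2" and t: "inner_product_space V t"
    and b1: "hilbert.bounded_form V ip1 t" and b2: "hilbert.bounded_form V ip2 t"
    and c1: "hilbert.inf_sup_form V ip1 t"
  shows "\<exists>C. \<forall>x\<in>V. ip_norm ip1 x \<le> C * ip_norm ip2 x"
proof -
  interpret h1: hilbert V ip1 by (rule 1)
  interpret h2: hilbert V ip2 by (rule 2)
  interpret t: inner_product V t by unfold_locales (rule t)
  obtain k1 where k1: "\<And>x y. x \<in> V \<Longrightarrow> y \<in> V \<Longrightarrow> cmod (t x y) \<le> k1 * h1.nrm x * h1.nrm y"
    using b1 by (auto simp: h1.bounded_form_def)
  obtain k2 where k2: "\<And>x y. x \<in> V \<Longrightarrow> y \<in> V \<Longrightarrow> cmod (t x y) \<le> k2 * h2.nrm x * h2.nrm y"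
    using b2 by (auto simp: h2.bounded_form_def)
  obtain M where M: "\<And>x. x \<in> V \<Longrightarrow> \<exists>y\<in>V. h1.nrm y \<le> M * h1.nrm x \<and> t x y = of_real ((h1.nrm x)\<^sup>2)"
    using c1 by (auto simp: h1.inf_sup_form_def)
  define B where "B = {y \<in> V. h2.nrm y \<le> 1}"
  have "\<exists>C\<ge>0. \<forall>y\<in>B. \<forall>x\<in>V. cmod (t x y) \<le> C * h1.nrm x"
  proof (rule h1.uniform_boundedness)
    fix y assume "y \<in> B"
    then have y: "y \<in> V" by (simp add: B_def)
    have "cmod (t x y) \<le> (k1 * h1.nrm y) * h1.nrm x" if "x \<in> V" for x
      using k1[OF that y] by (simp add: mult_ac)
    then show "\<exists>C. \<forall>x\<in>V. cmod (t x y) \<le> C * h1.nrm x" by blast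
    show "t (x + x') y = t x y + t x' y" if "x \<in> V" "x' \<in> V" for x x'
      using that y by (simp add: t.ip_linear)
    show "t (c *\<^sub>C x) y = c * t x y" if "x \<in> V" for c x
      using that y by (simp add: t.ip_linear)
  next
    fix x assume x: "x \<in> V"
    have "cmod (t x y) \<le> \<bar>k2\<bar> * h2.nrm x" if "y \<in> B" for y
    proof -
      have y: "y \<in> V" "h2.nrm y \<le> 1" using that by (auto simp: B_def)
      have "k2 * (h2.nrm x * h2.nrm y) \<le> \<bar>k2\<bar> * (h2.nrm x * 1)"
        using x y by (intro mult_mono) auto
      then show ?thesis using k2[OF x y(1)] by simp
    qed
    then show "\<exists>C. \<forall>y\<in>B. cmod (t x y) \<le> C" by blast
  qed
  then obtain C where C: "C \<ge> 0" "\<And>x y. x \<in> V \<Longrightarrow> y \<in> B \<Longrightarrow> cmod (t x y) \<le> C * h1.nrm x"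
    by blast
  have mixed: "cmod (t x y) \<le> C * h1.nrm x * h2.nrm y" if x: "x \<in> V" and y: "y \<in> V" for x y
  proof (cases "y = 0")
    case False
    then have pos: "h2.nrm y > 0" using y by (rule h2.nrm_pos[rotated])
    let ?u = "complex_of_real (1 / h2.nrm y) *\<^sub>C y"
    have "h2.nrm ?u = 1"
      using y pos False by (simp add: h2.nrm_scale norm_divide)
    then have "?u \<in> B" using y by (simp add: B_def)
    from C(2)[OF x this] have "cmod (t x y) / h2.nrm y \<le> C * h1.nrm x"
      using x y pos by (simp add: t.ip_linear norm_mult norm_divide)
    then show ?thesis using pos by (simp add: field_simps)
  qed (use x in simp)
  have "h1.nrm y \<le> (C * \<bar>M\<bar>) * h2.nrm y" if y: "y \<in> V" for y
  proof (cases "y = 0")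
    case False
    obtain x where x: "x \<in> V" "h1.nrm x \<le> M * h1.nrm y" "t y x = of_real ((h1.nrm y)\<^sup>2)"
      using M[OF y] by blast
    have "(h1.nrm y)\<^sup>2 = cmod (t x y)"
      using t.ip_commute[OF y x(1)] x(3) by (simp add: norm_power)
    also have "\<dots> \<le> C * h1.nrm x * h2.nrm y" by (rule mixed[OF x(1) y])
    also have "\<dots> \<le> C * (\<bar>M\<bar> * h1.nrm y) * h2.nrm y"
    proof -
      have "M * h1.nrm y \<le> \<bar>M\<bar> * h1.nrm y" using y by (intro mult_right_mono) auto
      then show ?thesis using x(2) C(1) y by (intro mult_right_mono mult_left_mono) auto
    qed
    finally have "h1.nrm y * h1.nrm y \<le> (C * \<bar>M\<bar> * h2.nrm y) * h1.nrm y"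
      by (simp add: power2_eq_square mult_ac)
    then show ?thesis using h1.nrm_pos[OF y False] by simp
  qed simp
  then show ?thesis by blast
qed

locale krein = inner_product K t for K :: "'a::complex_vector set" and t +
  assumes krein: "krein_space K t"
begin

abbreviation J where "J \<equiv> fund_sym K t"
abbreviation h where "h \<equiv> hilbert_ip K t"

text \<open>With the projection \<open>P\<close> onto the positive part, \<open>[Jx,y] = [Px,Py] - [(1-P)x,(1-P)y]\<close>. This is
hermitian and positive definite, and its norm is controlled from both sides by the norms of the two
components, each of which lives in a Hilbert space.\<close>

lemma fundamental_facts:
  shows "linear_on J" and "x \<in> K \<Longrightarrow> J (J x) = x"
    and "x \<in> K \<Longrightarrow> y \<in> K \<Longrightarrow> t (J x) y = t x (J y)" and "hilbert_space K h"
proof -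
  have "\<exists>J. fundamental_symmetry K t J"
    using krein by (auto simp: krein_space_def fundamental_symmetry_def)
  then have "fundamental_symmetry K t J"
    unfolding fund_sym_def by (rule someI_ex)
  then obtain Kp Km where dec: "fundamental_decomposition K t Kp Km"
    and J_def: "J = (\<lambda>x\<in>K. projection Kp Km x - projection Km Kp x)"
    by (auto simp: fundamental_symmetry_def)
  let ?tp = "\<lambda>x\<in>Kp. \<lambda>y\<in>Kp. t x y" and ?tm = "\<lambda>x\<in>Km. \<lambda>y\<in>Km. - t x y"
  interpret p: hilbert Kp ?tp
    by (rule hilbertI) (use dec in \<open>simp add: fundamental_decomposition_def\<close>)
  interpret m: hilbert Km ?tm
    by (rule hilbertI) (use dec in \<open>simp add: fundamental_decomposition_def\<close>)
  have K: "x \<in> K" if "x \<in> Kp \<or> x \<in> Km" for x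
    using dec that by (auto simp: fundamental_decomposition_def)
  have orth: "t x y = 0" "t y x = 0" if "x \<in> Kp" "y \<in> Km" for x y
  proof -
    show "t x y = 0" using dec that by (auto simp: fundamental_decomposition_def)
    then show "t y x = 0" using ip_commute[of x y] K that by simp
  qed
  have unique: "x = x'" if "x \<in> Kp" "x' \<in> Kp" "y - x \<in> Km" "y - x' \<in> Km" for x x' y
  proof -
    have "x - x' \<in> Km" using m.diff_in[OF that(4,3)] by simp
    then have "x - x' \<in> Kp \<inter> Km" using that by simp
    moreover have "Kp \<inter> Km = {0}" using dec by (simp add: fundamental_decomposition_def)
    ultimately show ?thesis by simp
  qed
  have ex: "\<exists>p. p \<in> Kp \<and> x - p \<in> Km" if "x \<in> K" for x
    using dec that by (fastforce simp: fundamental_decomposition_def)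
  define P where "P = projection Kp Km"
  have P_eq: "P x = p" if "p \<in> Kp" "x - p \<in> Km" for x p
    unfolding P_def projection_def by (rule the_equality) (use that unique in blast)+
  have P: "P x \<in> Kp" "x - P x \<in> Km" if "x \<in> K" for x
    using ex[OF that] P_eq by auto
  have Q_eq: "projection Km Kp x = x - P x" if "x \<in> K" for x
    unfolding projection_def
  proof (rule the_equality)
    show "x - P x \<in> Km \<and> x - (x - P x) \<in> Kp" using P[OF that] by simp
    show "q = x - P x" if "q \<in> Km \<and> x - q \<in> Kp" for q
      using P_eq[of "x - q" x] that by simp
  qed
  have J: "J x = P x - (x - P x)" if "x \<in> K" for x
    using that Q_eq by (simp add: J_def P_def)
  have P_add: "P (x + y) = P x + P y" if "x \<in> K" "y \<in> K" for x y
    using p.add_in[OF P(1) P(1)] m.add_in[OF P(2) P(2)] that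
    by (intro P_eq) (simp_all add: algebra_simps)
  have P_scale: "P (c *\<^sub>C x) = c *\<^sub>C P x" if "x \<in> K" for x c
    using p.scale_in[OF P(1)] m.scale_in[OF P(2), of x c] that
    by (intro P_eq) (simp_all add: complex_vector.scale_right_diff_distrib)
  have P_diff: "P (x - y) = P x - P y" if "x \<in> K" "y \<in> K" for x y
    using P_add[of "x - y" y] that by simp
  have PK: "P x \<in> K" if "x \<in> K" for x using P(1)[OF that] K by blast
  show lin: "linear_on J"
    unfolding linear_on_def
    using PK by (simp add: J P_add P_scale complex_vector.scale_right_diff_distrib)
  have PJ: "P (J x) = P x" if "x \<in> K" for x
    using P[OF that] by (intro P_eq) (simp_all add: J[OF that] m.minus_in[of "x - P x", simplified])
  show "J (J x) = x" if "x \<in> K" for x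
    unfolding J[OF linear_onD(1)[OF lin that]] PJ[OF that] using J[OF that] by simp
  have split: "t (J x) y = t (P x) (P y) - t (x - P x) (y - P y)" if "x \<in> K" "y \<in> K" for x y
  proof -
    have "t (J x) y = t (P x - (x - P x)) (P y + (y - P y))" using that by (simp add: J)
    also have "\<dots> = t (P x) (P y) - t (x - P x) (y - P y)"
      using orth[OF P(1) P(2), of x y] orth[OF P(1) P(2), of y x] that PK
      by (simp only: ip_add_left ip_add_right ip_diff_left[of "P x" "x - P x"] diff_in add_in)
        simp
    finally show ?thesis .
  qed
  have sym: "t (J x) y = cnj (t (J y) x)" if "x \<in> K" "y \<in> K" for x y
    using ip_commute[of "P y" "P x"] ip_commute[of "y - P y" "x - P x"] PK that by (simp add: split)
  show "t (J x) y = t x (J y)" if "x \<in> K" "y \<in> K" for x y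
    using sym[OF that] ip_commute[of "J y" x] linear_onD(1)[OF lin] that by simp
  have JK: "J x \<in> K" if "x \<in> K" for x by (rule linear_onD(1)[OF lin that])
  have h: "inner_product_space K h"
    unfolding inner_product_space_def hermitian_form_def hilbert_ip_def
  proof (intro conjI ballI allI subspace)
    show "(\<lambda>x\<in>K. \<lambda>y\<in>K. t (J x) y) y x = cnj ((\<lambda>x\<in>K. \<lambda>y\<in>K. t (J x) y) x y)"
      if "x \<in> K" "y \<in> K" for x y
      using that sym[of y x] by simp
  qed (simp_all add: linear_onD[OF lin] ip_linear)
  interpret h: inner_product K h by unfold_locales (rule h)
  have hxx: "Re (h x x) = (p.nrm (P x))\<^sup>2 + (m.nrm (x - P x))\<^sup>2" if "x \<in> K" for x
    using that P[OF that] by (simp add: hilbert_ip_def split p.nrm_power2 m.nrm_power2)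
  interpret h: pre_hilbert K h
  proof
    fix x assume x: "x \<in> K" "x \<noteq> 0"
    show "0 < Re (h x x)"
    proof (rule ccontr)
      assume "\<not> ?thesis"
      then have "p.nrm (P x) = 0" "m.nrm (x - P x) = 0"
        using hxx[OF x(1)] by (smt (verit) zero_le_power2 zero_eq_power2)+
      then have "P x = 0" "x - P x = 0" using P[OF x(1)] by simp_all
      then show False using x(2) by simp
    qed
  qed
  have nrm: "(h.nrm x)\<^sup>2 = (p.nrm (P x))\<^sup>2 + (m.nrm (x - P x))\<^sup>2" if "x \<in> K" for x
    using that by (simp add: h.nrm_power2 hxx)
  have p_le: "p.nrm (P x) \<le> h.nrm x" and m_le: "m.nrm (x - P x) \<le> h.nrm x" if "x \<in> K" for x
    by (rule power2_le_imp_le; use nrm[OF that] that in simp)+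
  have le_sum: "h.nrm x \<le> p.nrm (P x) + m.nrm (x - P x)" if "x \<in> K" for x
    by (rule power2_le_imp_le) (use nrm[OF that] P[OF that] in \<open>simp_all add: power2_sum\<close>)
  show "hilbert_space K h"
  proof (rule h.hilbert_spaceI)
    fix s :: "nat \<Rightarrow> 'a"
    assume s: "\<And>n. s n \<in> K"
      and cauchy: "\<And>e. e > 0 \<Longrightarrow> \<exists>N. \<forall>k\<ge>N. \<forall>n\<ge>N. h.nrm (s k - s n) < e"
    have d: "s k - s n \<in> K" for k n using s by simp
    have "p.nrm (P (s k) - P (s n)) \<le> h.nrm (s k - s n)" for k n
      using p_le[OF d, of k n] s by (simp add: P_diff)
    then have "\<exists>N. \<forall>k\<ge>N. \<forall>n\<ge>N. p.nrm (P (s k) - P (s n)) < e" if "e > 0" for e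
      using cauchy[OF that] by (meson le_less_trans)
    then obtain a where a: "p.conv (\<lambda>n. P (s n)) a"
      using p.cauchy_convergent[of "\<lambda>n. P (s n)"] P(1)[OF s] by blast
    have "m.nrm ((s k - P (s k)) - (s n - P (s n))) \<le> h.nrm (s k - s n)" for k n
      using m_le[OF d, of k n] s by (simp add: P_diff algebra_simps)
    then have "\<exists>N. \<forall>k\<ge>N. \<forall>n\<ge>N. m.nrm ((s k - P (s k)) - (s n - P (s n))) < e" if "e > 0" for e
      using cauchy[OF that] by (meson le_less_trans)
    then obtain b where b: "m.conv (\<lambda>n. s n - P (s n)) b"
      using m.cauchy_convergent[of "\<lambda>n. s n - P (s n)"] P(2)[OF s] by blast
    have ab: "a \<in> Kp" "b \<in> Km" using p.convD[OF a] m.convD[OF b] by blast+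
    have abK: "a + b \<in> K" using ab K by (intro add_in) blast+
    have Pab: "P (a + b) = a" using ab by (intro P_eq) simp_all
    have "(\<lambda>n. p.nrm (P (s n) - a) + m.nrm ((s n - P (s n)) - b)) \<longlonglongrightarrow> 0"
      using a b by (auto simp: p.conv_def m.conv_def intro: tendsto_add_zero)
    moreover have "h.nrm (s n - (a + b)) \<le> p.nrm (P (s n) - a) + m.nrm ((s n - P (s n)) - b)" for n
      using le_sum[OF diff_in[OF s abK], of n] s abK by (simp add: P_diff Pab algebra_simps)
    ultimately have "(\<lambda>n. h.nrm (s n - (a + b))) \<longlonglongrightarrow> 0"
      by (rule null_sandwich) (use s abK in auto)
    then have "h.conv s (a + b)" using s abK by (simp add: h.conv_def)
    then show "\<exists>x. h.conv s x" ..
  qed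
qed

sublocale hil: hilbert K h
  by (rule hilbertI) (rule fundamental_facts)

lemmas J_linear = linear_onD[OF fundamental_facts(1)]
lemmas J_J = fundamental_facts(2)
lemmas J_sym = fundamental_facts(3)

lemma h_eq: "x \<in> K \<Longrightarrow> y \<in> K \<Longrightarrow> h x y = t (J x) y"
  by (simp add: hilbert_ip_def)

lemma h_eq': "x \<in> K \<Longrightarrow> y \<in> K \<Longrightarrow> h x y = t x (J y)"
  by (simp add: h_eq J_sym)

lemma t_eq: "x \<in> K \<Longrightarrow> y \<in> K \<Longrightarrow> t x y = h (J x) y"
  by (simp add: h_eq J_linear J_J)

lemma nrm_J: "x \<in> K \<Longrightarrow> hil.nrm (J x) = hil.nrm x"
  using h_eq'[of "J x" "J x"] h_eq[of x x] by (simp add: ip_norm_def J_linear J_J J_sym)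

lemma form_le: "x \<in> K \<Longrightarrow> y \<in> K \<Longrightarrow> cmod (t x y) \<le> hil.nrm x * hil.nrm y"
  using hil.cauchy_schwarz[of "J x" y] by (simp add: t_eq nrm_J J_linear)

lemma form_J: "x \<in> K \<Longrightarrow> t x (J x) = of_real ((hil.nrm x)\<^sup>2)"
  using hil.ip_self[of x] by (simp add: h_eq')

lemma bounded: "hil.bounded_form t"
  unfolding hil.bounded_form_def by (rule exI[of _ 1]) (simp add: form_le)

lemma inf_sup: "hil.inf_sup_form t"
  unfolding hil.inf_sup_form_def
proof (intro exI[of _ 1] ballI)
  show "\<exists>y\<in>K. hil.nrm y \<le> 1 * hil.nrm x \<and> t x y = of_real ((hil.nrm x)\<^sup>2)" if "x \<in> K" for x
    using that by (intro bexI[of _ "J x"]) (simp_all add: form_J nrm_J J_linear)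
qed

lemma krein_dense_iff:
  "W \<subseteq> K \<Longrightarrow> krein_topology K t closure_of W = K \<longleftrightarrow> (\<forall>x\<in>K. \<forall>e>0. \<exists>w\<in>W. hil.nrm (x - w) < e)"
  unfolding krein_topology_def by (rule hil.dense_iff)

text \<open>The usual equivalence of continuity and boundedness, for the identity as a linear map.\<close>

lemma continuously_embedded_iff:
  assumes "hilbert H ip"
  shows "continuously_embedded K t H ip \<longleftrightarrow>
    K \<subseteq> H \<and> (\<exists>C. \<forall>x\<in>K. ip_norm ip x \<le> C * hil.nrm x)"
proof (cases "K \<subseteq> H")
  case True
  interpret H: hilbert H ip by fact
  have KH: "x \<in> H" if "x \<in> K" for x using that True by blast
  have "continuous_map (krein_topology K t) (ip_topology H ip) (\<lambda>x. x) \<longleftrightarrow>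
      (\<forall>a\<in>K. \<forall>e>0. \<exists>d>0. \<forall>x. x \<in> K \<and> hil.nrm (a - x) < d \<longrightarrow> H.nrm (a - x) < e)"
    unfolding krein_topology_def hil.ip_topology_eq H.ip_topology_eq
      hil.metric.metric_continuous_map[OF H.metric.Metric_space_axioms]
    using True KH by (auto simp: hil.ip_dist_nrm H.ip_dist_nrm cong: conj_cong)
  also have "\<dots> \<longleftrightarrow> (\<exists>C. \<forall>x\<in>K. H.nrm x \<le> C * hil.nrm x)"
  proof
    assume "\<forall>a\<in>K. \<forall>e>0. \<exists>d>0. \<forall>x. x \<in> K \<and> hil.nrm (a - x) < d \<longrightarrow> H.nrm (a - x) < e"
    then obtain d where d: "d > 0" "\<And>x. x \<in> K \<Longrightarrow> hil.nrm (0 - x) < d \<Longrightarrow> H.nrm (0 - x) < 1"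
      using zero_in zero_less_one by meson
    have "H.nrm x \<le> (2 / d) * hil.nrm x" if x: "x \<in> K" for x
    proof (cases "x = 0")
      case False
      then have pos: "hil.nrm x > 0" using x by (rule hil.nrm_pos[rotated])
      define c where "c = d / (2 * hil.nrm x)"
      have c: "c > 0" using pos d(1) by (simp add: c_def)
      have "hil.nrm (complex_of_real c *\<^sub>C x) = d / 2"
        using x c pos False by (simp add: hil.nrm_scale) (simp add: c_def)
      then have "H.nrm (complex_of_real c *\<^sub>C x) < 1"
        using d(2)[of "complex_of_real c *\<^sub>C x"] d(1) x KH by (simp add: hil.nrm_minus H.nrm_minus)
      then have "c * H.nrm x < 1" using c x KH by (simp add: H.nrm_scale)
      then show ?thesis using pos d(1) by (simp add: c_def field_simps)
    qed simp
    then show "\<exists>C. \<forall>x\<in>K. H.nrm x \<le> C * hil.nrm x" by blast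
  next
    assume "\<exists>C. \<forall>x\<in>K. H.nrm x \<le> C * hil.nrm x"
    then obtain C where C: "\<And>x. x \<in> K \<Longrightarrow> H.nrm x \<le> C * hil.nrm x" by blast
    show "\<forall>a\<in>K. \<forall>e>0. \<exists>d>0. \<forall>x. x \<in> K \<and> hil.nrm (a - x) < d \<longrightarrow> H.nrm (a - x) < e"
    proof (intro ballI allI impI)
      fix a and e :: real assume a: "a \<in> K" and e: "e > 0"
      define d where "d = e / (\<bar>C\<bar> + 1)"
      have "H.nrm (a - x) < e" if x: "x \<in> K" "hil.nrm (a - x) < d" for x
      proof -
        have "H.nrm (a - x) \<le> C * hil.nrm (a - x)" using C a x(1) by simp
        also have "\<dots> \<le> (\<bar>C\<bar> + 1) * hil.nrm (a - x)"
          using a x(1) by (intro mult_right_mono) auto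
        also have "\<dots> < (\<bar>C\<bar> + 1) * d"
          using x(2) by (intro mult_strict_left_mono) auto
        finally show ?thesis by (simp add: d_def)
      qed
      moreover have "d > 0" using e by (simp add: d_def)
      ultimately show "\<exists>d>0. \<forall>x. x \<in> K \<and> hil.nrm (a - x) < d \<longrightarrow> H.nrm (a - x) < e" by blast
    qed
  qed
  finally show ?thesis using True by (simp add: continuously_embedded_def)
qed (simp add: continuously_embedded_def)

end

lemma kreinI: "krein_space K t \<Longrightarrow> krein K t"
  by unfold_locales (auto simp: krein_space_def)

section \<open>Representing operators of closed forms\<close>

lemma shifted_form_0:
  assumes "t \<in> D \<rightarrow>\<^sub>E D \<rightarrow>\<^sub>E UNIV"
  shows "shifted_form ip D t 0 = t"
proof (intro ext)
  show "shifted_form ip D t 0 u v = t u v" for u v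
    using assms by (cases "u \<in> D"; cases "v \<in> D")
      (auto simp: shifted_form_def PiE_def extensional_def Pi_def)
qed

text \<open>Two operators that represent the same form satisfy \<open>(S'x,u) = t[x,u] = (x,Su)\<close>, so \<open>S\<close> is contained
in the adjoint of \<open>S'\<close>, which is \<open>S'\<close> itself.\<close>

lemma self_adjoint_representation_subset:
  assumes S: "self_adjoint H ip S" "Domain S \<subseteq> D" "\<And>u v. u \<in> Domain S \<Longrightarrow> v \<in> D \<Longrightarrow> t u v = ip (op_app S u) v"
    and S': "self_adjoint H ip S'" "Domain S' \<subseteq> D"
      "\<And>u v. u \<in> Domain S' \<Longrightarrow> v \<in> D \<Longrightarrow> t u v = ip (op_app S' u) v"
    and ip: "inner_product_space H ip" and t: "inner_product_space D t"
  shows "S \<subseteq> S'"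
proof
  interpret H: inner_product H ip by unfold_locales (rule ip)
  interpret t: inner_product D t by unfold_locales (rule t)
  have app: "op_app A x = y" if "(x, y) \<in> A" "self_adjoint H ip A" for A x y
    using that by (auto simp: op_app_def self_adjoint_def linear_operator_def single_valued_def)
  fix uw assume "uw \<in> S"
  then obtain u w where uw: "uw = (u, w)" "(u, w) \<in> S" by (cases uw) auto
  have H: "u \<in> H" "w \<in> H" using uw S(1) by (auto simp: self_adjoint_def linear_operator_def)
  have "ip y u = ip x w" if xy: "(x, y) \<in> S'" for x y
  proof -
    have D: "x \<in> D" "u \<in> D" using xy uw S(2) S'(2) by auto
    have "x \<in> H" using xy S'(1) by (auto simp: self_adjoint_def linear_operator_def)
    have "ip y u = t x u" using S'(3)[OF DomainI[OF xy] D(2)] app[OF xy S'(1)] by simp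
    also have "\<dots> = cnj (t u x)" using t.ip_commute[OF D(2,1)] by simp
    also have "t u x = ip w x" using S(3)[OF DomainI[OF uw(2)] D(1)] app[OF uw(2) S(1)] by simp
    finally show ?thesis using H.ip_commute[OF H(2) \<open>x \<in> H\<close>] by simp
  qed
  then have "(u, w) \<in> op_adjoint H ip S'" using H by (auto simp: op_adjoint_def)
  then show "uw \<in> S'" using S'(1) uw by (simp add: self_adjoint_def)
qed

lemma Domain_linear_operator_subspace:
  assumes "linear_operator H A"
  shows "complex_vector.subspace (Domain A)"
  unfolding complex_vector.subspace_def
proof (intro conjI ballI allI)
  have A: "(0, 0) \<in> A" "\<And>x y x' y'. (x, y) \<in> A \<Longrightarrow> (x', y') \<in> A \<Longrightarrow> (x + x', y + y') \<in> A"
    "\<And>c x y. (x, y) \<in> A \<Longrightarrow> (c *\<^sub>C x, c *\<^sub>C y) \<in> A"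
    using assms by (auto simp: linear_operator_def)
  show "0 \<in> Domain A" using A(1) by blast
  show "x + x' \<in> Domain A" if "x \<in> Domain A" "x' \<in> Domain A" for x x'
    using that A(2) by blast
  show "c *\<^sub>C x \<in> Domain A" if "x \<in> Domain A" for c x
    using that A(3) by blast
qed

definition represents ::
  "'a::complex_vector set \<Rightarrow> ('a \<Rightarrow> 'a \<Rightarrow> complex) \<Rightarrow> 'a set \<Rightarrow> ('a \<Rightarrow> 'a \<Rightarrow> complex) \<Rightarrow> ('a \<times> 'a) set \<Rightarrow> bool"
  where "represents H ip D t S \<longleftrightarrow> self_adjoint H ip S \<and> Domain S \<subseteq> D \<and>
    (\<forall>u\<in>Domain S. \<forall>v\<in>D. t u v = ip (op_app S u) v)"

lemma representing_operator_unique: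
  assumes "inner_product_space H ip" "inner_product_space D t"
    and "represents H ip D t S" "represents H ip D t S'"
  shows "S = S'"
  using assms by (intro equalityI self_adjoint_representation_subset[of H ip _ D t])
    (auto simp: represents_def)

lemma representing_operator_eq:
  assumes "inner_product_space H ip" "inner_product_space D t" and "represents H ip D t S"
  shows "representing_operator H ip D t = S"
  unfolding representing_operator_def represents_def[symmetric]
  by (rule the_equality) (use assms representing_operator_unique in blast)+

lemma (in pre_hilbert) orthogonal_dense_zero:
  assumes W: "W \<subseteq> V" "ip_topology V ip closure_of W = V" and g: "g \<in> V"
    and orth: "\<And>w. w \<in> W \<Longrightarrow> ip g w = 0"
  shows "g = 0"
proof -
  obtain s where s: "\<And>n. s n \<in> W" "conv s g"
    using conv_of_approx[OF g W(1)] W(2) g dense_iff[OF W(1)] by blast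
  have "(\<lambda>n. ip g (s n)) \<longlonglongrightarrow> ip g g" by (rule conv_ip_right[OF s(2) g])
  then have "ip g g = 0" using orth[OF s(1)] by (simp add: LIMSEQ_const_iff)
  then show ?thesis using ip_self_pos[OF g] by force
qed

text \<open>For \<open>f \<in> H\<close> the functional \<open>(\<cdot>,f)\<close> is bounded on \<open>D\<close>, so the Riesz theorem in the Hilbert space \<open>D\<close>,
followed by \<open>J\<close>, produces \<open>u \<in> D\<close> with \<open>t[u,v] = (f,v)\<close> for all \<open>v \<in> D\<close>. The operator \<open>S\<close> is the inverse of
\<open>f \<mapsto> u\<close>. This inverse relation is everywhere defined on \<open>H\<close> and symmetric, which gives
self-adjointness; that \<open>S\<close> is single valued uses the density of \<open>D\<close> in \<open>H\<close>.\<close>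

lemma representing_operator_exists:
  assumes H: "hilbert_space H ip" and K: "krein_space D t"
    and emb: "continuously_embedded D t H ip"
    and dense: "ip_topology H ip closure_of D = H"
  shows "\<exists>S. represents H ip D t S"
proof -
  interpret H: hilbert H ip by (rule hilbertI[OF H])
  interpret K: krein D t by (rule kreinI[OF K])
  obtain C where DH: "D \<subseteq> H" and C: "\<And>x. x \<in> D \<Longrightarrow> H.nrm x \<le> C * K.hil.nrm x"
    using emb K.continuously_embedded_iff[OF H.hilbert_axioms] by blast
  have DinH: "x \<in> H" if "x \<in> D" for x using that DH by blast
  define S where "S = {(u, f). f \<in> H \<and> u \<in> D \<and> (\<forall>v\<in>D. t u v = ip f v)}"
  have ex: "\<exists>u. (u, f) \<in> S" if f: "f \<in> H" for f
  proof -
    have "\<exists>w\<in>D. \<forall>v\<in>D. ip v f = K.h v w"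
    proof (rule K.hil.riesz)
      fix v assume v: "v \<in> D"
      have "cmod (ip v f) \<le> H.nrm v * H.nrm f" using H.cauchy_schwarz v f DinH by blast
      also have "\<dots> \<le> (C * K.hil.nrm v) * H.nrm f"
        using C[OF v] f by (intro mult_right_mono) auto
      finally show "cmod (ip v f) \<le> (C * H.nrm f) * K.hil.nrm v" by (simp add: mult_ac)
    qed (use f DinH in \<open>auto simp: H.ip_linear\<close>)
    then obtain w where w: "w \<in> D" "\<And>v. v \<in> D \<Longrightarrow> ip v f = K.h v w" by blast
    have "t (K.J w) v = ip f v" if v: "v \<in> D" for v
      using w(2)[OF v] H.ip_commute[OF DinH[OF v] f] K.hil.ip_commute[OF v w(1)] K.h_eq[OF w(1) v] by simp
    then have "(K.J w, f) \<in> S" using f w(1) K.J_linear(1) by (simp add: S_def)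
    then show ?thesis ..
  qed
  have S: "f \<in> H" "u \<in> D" "v \<in> D \<Longrightarrow> t u v = ip f v" if "(u, f) \<in> S" for u f v
    using that by (auto simp: S_def)
  have inj: "f = f'" if "(u, f) \<in> S" "(u, f') \<in> S" for u f f'
  proof -
    have "ip (f - f') w = 0" if "w \<in> D" for w
    proof -
      have "ip f w = ip f' w" using S(3)[OF _ \<open>w \<in> D\<close>] that \<open>(u, f) \<in> S\<close> \<open>(u, f') \<in> S\<close> by metis
      then show ?thesis
        using S(1)[OF \<open>(u, f) \<in> S\<close>] S(1)[OF \<open>(u, f') \<in> S\<close>] DinH[OF \<open>w \<in> D\<close>] by (simp add: H.ip_linear)
    qed
    then have "f - f' = 0"
      using S(1)[OF that(1)] S(1)[OF that(2)] by (intro H.orthogonal_dense_zero[OF DH dense]) auto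
    then show ?thesis by simp
  qed
  have swap: "ip y u = ip x w" if xy: "(x, y) \<in> S" and uw: "(u, w) \<in> S" for x y u w
  proof -
    note xD = S(2)[OF xy] and uD = S(2)[OF uw]
    have "ip y u = cnj (t u x)"
      using S(3)[OF xy uD] K.ip_commute[OF uD xD] by simp
    then show ?thesis
      using S(3)[OF uw xD] H.ip_commute[OF S(1)[OF uw] DinH[OF xD]] by simp
  qed
  have lin: "linear_operator H S"
    unfolding linear_operator_def
  proof (intro conjI)
    show "S \<subseteq> H \<times> H" using DinH by (auto simp: S_def)
    show "single_valued S" using inj by (auto simp: single_valued_def)
    show "(0, 0) \<in> S" using DinH by (simp add: S_def)
    show "\<forall>(x, y)\<in>S. \<forall>(x', y')\<in>S. (x + x', y + y') \<in> S"
      using DinH by (auto simp: S_def K.ip_linear H.ip_linear)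
    show "\<forall>c. \<forall>(x, y)\<in>S. (c *\<^sub>C x, c *\<^sub>C y) \<in> S"
      using DinH by (auto simp: S_def K.ip_linear H.ip_linear)
  qed
  have dom: "Domain S \<subseteq> D" by (auto simp: S_def)
  have sub: "complex_vector.subspace (Domain S)"
    by (rule Domain_linear_operator_subspace[OF lin])
  have "ip_topology H ip closure_of Domain S = H"
  proof (rule H.dense_of_orthogonal_trivial[OF sub])
    show "Domain S \<subseteq> H" using dom DH by blast
    fix v assume v: "v \<in> H" and orth: "\<And>w. w \<in> Domain S \<Longrightarrow> ip v w = 0"
    obtain u where u: "(u, v) \<in> S" using ex[OF v] by blast
    obtain x where x: "(x, u) \<in> S" using ex DinH S(2)[OF u] by blast
    have "ip u u = 0" using swap[OF x u] orth[of x] H.ip_commute[OF v DinH[OF S(2)[OF x]]] x by auto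
    then have "u = 0" using H.ip_self_pos[of u] DinH[OF S(2)[OF u]] by fastforce
    then have "(0, v) \<in> S" using u by simp
    moreover have "(0, 0) \<in> S" using lin by (simp add: linear_operator_def)
    ultimately show "v = 0" using inj by blast
  qed
  then have "densely_defined (ip_topology H ip) S"
    by (simp add: densely_defined_def H.ip_topology_eq)
  moreover have "op_adjoint H ip S = S"
  proof (intro equalityI subsetI)
    fix p assume "p \<in> op_adjoint H ip S"
    then obtain v w where p: "p = (v, w)" "v \<in> H" "w \<in> H" and adj: "\<And>x y. (x, y) \<in> S \<Longrightarrow> ip y v = ip x w"
      unfolding op_adjoint_def by blast
    obtain z where z: "(z, w) \<in> S" using ex[OF p(3)] by blast
    have "ip v y = ip z y" if y: "y \<in> H" for y
    proof -
      obtain x where x: "(x, y) \<in> S" using ex[OF y] by blast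
      show ?thesis
        using adj[OF x] swap[OF x z] H.ip_commute[OF y p(2)] H.ip_commute[OF y DinH[OF S(2)[OF z]]]
        by simp
    qed
    then have "v = z" using p(2) DinH[OF S(2)[OF z]] by (intro H.eqI_ip[rotated 2])
    then show "p \<in> S" using z p by simp
  next
    fix p assume "p \<in> S"
    then show "p \<in> op_adjoint H ip S"
      using swap DinH by (cases p) (auto simp: op_adjoint_def dest: S)
  qed
  moreover have "t u v = ip (op_app S u) v" if "u \<in> Domain S" "v \<in> D" for u v
  proof -
    obtain f where f: "(u, f) \<in> S" using \<open>u \<in> Domain S\<close> by blast
    then have "op_app S u = f" using inj by (auto simp: op_app_def)
    then show ?thesis using S(3)[OF f that(2)] by simp
  qed
  ultimately have "represents H ip D t S"
    using lin dom by (simp add: represents_def self_adjoint_def)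
  then show ?thesis ..
qed


section \<open>Closures and completions of the form of an invertible self-adjoint operator\<close>

locale invertible_self_adjoint = hilbert H ip for H :: "'a::complex_vector set" and ip +
  fixes T :: "('a \<times> 'a) set"
  assumes self_adjoint: "self_adjoint H ip T"
    and invertible: "boundedly_invertible H ip T"
begin

lemma T_linear: "linear_operator H T"
  using self_adjoint by (simp add: self_adjoint_def)

lemma T_in: "(x, y) \<in> T \<Longrightarrow> x \<in> H" "(x, y) \<in> T \<Longrightarrow> y \<in> H"
  using T_linear by (auto simp: linear_operator_def)

lemma T_add: "(x, y) \<in> T \<Longrightarrow> (x', y') \<in> T \<Longrightarrow> (x + x', y + y') \<in> T"
  using T_linear by (auto simp: linear_operator_def)

lemma T_scale: "(x, y) \<in> T \<Longrightarrow> (c *\<^sub>C x, c *\<^sub>C y) \<in> T"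
  using T_linear by (auto simp: linear_operator_def)

lemma T_zero: "(0, 0) \<in> T"
  using T_linear by (simp add: linear_operator_def)

lemma T_unique: "(x, y) \<in> T \<Longrightarrow> (x, y') \<in> T \<Longrightarrow> y = y'"
  using T_linear by (auto simp: linear_operator_def single_valued_def)

lemma T_inj: "(x, y) \<in> T \<Longrightarrow> (x', y) \<in> T \<Longrightarrow> x = x'"
  using invertible by (auto simp: boundedly_invertible_def single_valued_def)

lemma op_app_T: "(x, y) \<in> T \<Longrightarrow> op_app T x = y"
  unfolding op_app_def using T_unique by blast

lemma T_surj: "f \<in> H \<Longrightarrow> \<exists>x. (x, f) \<in> T"
  using invertible by (auto simp: boundedly_invertible_def)

lemma dom_subspace: "complex_vector.subspace (Domain T)"
  by (rule Domain_linear_operator_subspace[OF T_linear])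

lemma dom_dense: "ip_topology H ip closure_of Domain T = H"
  using self_adjoint by (simp add: self_adjoint_def densely_defined_def ip_topology_eq)

lemma inverse_bounded: "\<exists>C\<ge>0. \<forall>(x, y)\<in>T. nrm x \<le> C * nrm y"
proof -
  obtain C where C: "\<forall>(x, y)\<in>T. ip_dist H ip x 0 \<le> C * ip_dist H ip y 0"
    using invertible by (auto simp: boundedly_invertible_def)
  have "nrm x \<le> \<bar>C\<bar> * nrm y" if "(x, y) \<in> T" for x y
  proof -
    have "nrm x \<le> C * nrm y" using C that T_in[OF that] by (auto simp: ip_dist_nrm)
    also have "\<dots> \<le> \<bar>C\<bar> * nrm y" using T_in[OF that] by (intro mult_right_mono) auto
    finally show ?thesis .
  qed
  then show ?thesis by (intro exI[of _ "\<bar>C\<bar>"]) auto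
qed

lemma op_form_T: "(x, y) \<in> T \<Longrightarrow> v \<in> Domain T \<Longrightarrow> op_form ip T x v = ip y v"
  by (auto simp: op_form_def op_app_T)

text \<open>For fixed \<open>(x, y) \<in> T\<close> both sides are continuous in \<open>v\<close> for the norm of \<open>D\<close>, and they agree on the dense
subspace \<open>dom T\<close>.\<close>

lemma form_extends_by_density:
  assumes h: "hilbert D h" and DH: "D \<subseteq> H" and emb: "\<And>x. x \<in> D \<Longrightarrow> nrm x \<le> C * ip_norm h x"
    and t: "inner_product_space D t" and bnd: "hilbert.bounded_form D h t"
    and dom: "Domain T \<subseteq> D" and dense: "\<forall>x\<in>D. \<forall>e>0. \<exists>w\<in>Domain T. ip_norm h (x - w) < e"
    and ext: "\<forall>u\<in>Domain T. \<forall>v\<in>Domain T. t u v = op_form ip T u v"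
    and xy: "(x, y) \<in> T" and v: "v \<in> D"
  shows "t x v = ip y v"
proof -
  interpret h: hilbert D h by (rule h)
  interpret t: inner_product D t by unfold_locales (rule t)
  have DinH: "x \<in> H" if "x \<in> D" for x using that DH by blast
  have xD: "x \<in> D" and yH: "y \<in> H" using xy dom T_in[OF xy] by blast+
  obtain s where s: "\<And>n. s n \<in> Domain T" "h.conv s v"
    using h.conv_of_approx[OF v dom] dense v by blast
  note sD = h.convD(1)[OF s(2)]
  obtain k where k: "\<And>x y. x \<in> D \<Longrightarrow> y \<in> D \<Longrightarrow> cmod (t x y) \<le> k * h.nrm x * h.nrm y"
    using bnd by (auto simp: h.bounded_form_def)
  show ?thesis
  proof (rule LIMSEQ_unique)
    show "(\<lambda>n. t x (s n)) \<longlonglongrightarrow> t x v"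
      by (rule h.conv_functional[OF s(2), where C = "k * h.nrm x"])
        (use k[OF xD, of "s _ - v"] sD v xD in \<open>simp add: t.ip_linear\<close>)
    have "(\<lambda>n. ip y (s n)) \<longlonglongrightarrow> ip y v"
    proof (rule h.conv_functional[OF s(2), where C = "nrm y * C"])
      fix n
      have "cmod (ip y (s n) - ip y v) \<le> nrm y * nrm (s n - v)"
        using cauchy_schwarz[of y "s n - v"] yH DinH[OF sD[of n]] DinH[OF v] by (simp add: ip_linear)
      also have "\<dots> \<le> nrm y * (C * h.nrm (s n - v))"
        using emb[of "s n - v"] sD v yH by (intro mult_left_mono) auto
      finally show "cmod (ip y (s n) - ip y v) \<le> nrm y * C * h.nrm (s n - v)" by (simp add: mult_ac)
    qed
    moreover have "t x (s n) = ip y (s n)" for n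
      using ext s(1)[of n] xy op_form_T[OF xy s(1)[of n]] by (metis DomainI)
    ultimately show "(\<lambda>n. t x (s n)) \<longlonglongrightarrow> ip y v" by simp
  qed
qed

text \<open>The norm of \<open>x = T\<^sup>-\<^sup>1 y\<close> in \<open>D\<close> is tested with \<open>Jx\<close>: \<open>\<parallel>x\<parallel>\<^sup>2 = t\<^sub>l[x,Jx] = (y - l x,Jx)\<close>, and the right-hand side
is at most a multiple of \<open>\<parallel>y\<parallel>\<^sub>H \<parallel>x\<parallel>\<close> since \<open>T\<^sup>-\<^sup>1\<close> is bounded in \<open>H\<close> and the embedding is continuous. The shift \<open>l\<close> is needed because
this bound is what moves the gap point to \<open>0\<close>; with \<open>l = 0\<close> it gives the inverse of \<open>A\<close>.\<close>

lemma inverse_bounded_into_form_domain: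
  assumes K: "krein_space D (shifted_form ip D t l)" and DH: "D \<subseteq> H"
    and emb: "\<And>x. x \<in> D \<Longrightarrow> nrm x \<le> C * ip_norm (hilbert_ip D (shifted_form ip D t l)) x"
    and dom: "Domain T \<subseteq> D"
    and rep: "\<And>x y v. (x, y) \<in> T \<Longrightarrow> v \<in> D \<Longrightarrow> t x v = ip y v"
  shows "\<exists>B\<ge>0. \<forall>(x, y)\<in>T. ip_norm (hilbert_ip D (shifted_form ip D t l)) x \<le> B * nrm y"
proof -
  let ?s = "shifted_form ip D t l"
  interpret K: krein D ?s by (rule kreinI[OF K])
  have DinH: "x \<in> H" if "x \<in> D" for x using that DH by blast
  obtain B where B: "B \<ge> 0" "\<forall>(x, y)\<in>T. nrm x \<le> B * nrm y" using inverse_bounded by blast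
  have "K.hil.nrm x \<le> ((1 + \<bar>l\<bar> * B) * \<bar>C\<bar>) * nrm y" if xy: "(x, y) \<in> T" for x y
  proof (cases "x = 0")
    case False
    have x: "x \<in> D" "x \<in> H" "y \<in> H" using xy dom T_in[OF xy] by blast+
    have Jx: "K.J x \<in> D" by (rule K.J_linear(1)[OF x(1)])
    have "of_real ((K.hil.nrm x)\<^sup>2) = ?s x (K.J x)" by (rule K.form_J[symmetric, OF x(1)])
    also have "\<dots> = ip (y - complex_of_real l *\<^sub>C x) (K.J x)"
      using x Jx DinH[OF Jx] rep[OF xy Jx] by (simp add: shifted_form_def ip_linear)
    finally have "(K.hil.nrm x)\<^sup>2 = cmod (ip (y - complex_of_real l *\<^sub>C x) (K.J x))"
      by (metis abs_power2 norm_of_real)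
    also have "\<dots> \<le> nrm (y - complex_of_real l *\<^sub>C x) * nrm (K.J x)"
      using x DinH[OF Jx] by (intro cauchy_schwarz) auto
    also have "\<dots> \<le> ((1 + \<bar>l\<bar> * B) * nrm y) * (\<bar>C\<bar> * K.hil.nrm x)"
    proof (rule mult_mono)
      have "\<bar>l\<bar> * nrm x \<le> \<bar>l\<bar> * (B * nrm y)"
        using B(2) xy by (intro mult_left_mono) auto
      then show "nrm (y - complex_of_real l *\<^sub>C x) \<le> (1 + \<bar>l\<bar> * B) * nrm y"
        using nrm_triangle_diff[of y "complex_of_real l *\<^sub>C x"] x by (simp add: nrm_scale algebra_simps)
      have "nrm (K.J x) \<le> C * K.hil.nrm x"
        using emb[OF Jx] K.nrm_J[OF x(1)] by simp
      also have "\<dots> \<le> \<bar>C\<bar> * K.hil.nrm x" using x(1) by (intro mult_right_mono) auto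
      finally show "nrm (K.J x) \<le> \<bar>C\<bar> * K.hil.nrm x" .
    qed (use B(1) x DinH[OF Jx] in auto)
    finally have "K.hil.nrm x * K.hil.nrm x \<le> (((1 + \<bar>l\<bar> * B) * \<bar>C\<bar>) * nrm y) * K.hil.nrm x"
      by (simp add: power2_eq_square mult_ac)
    then show ?thesis using K.hil.nrm_pos[OF x(1) False] by simp
  qed (use T_in[OF xy] B(1) in simp)
  moreover have "(1 + \<bar>l\<bar> * B) * \<bar>C\<bar> \<ge> 0" using B(1) by simp
  ultimately show ?thesis by (intro exI[of _ "(1 + \<bar>l\<bar> * B) * \<bar>C\<bar>"]) auto
qed

text \<open>The description to which both closures and completions are reduced; it makes no reference to gap
points.\<close>

abbreviation completes :: "'a set \<Rightarrow> ('a \<Rightarrow> 'a \<Rightarrow> complex) \<Rightarrow> bool" where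
  "completes D t \<equiv> krein_completion D t (Domain T) (op_form ip T) \<and> continuously_embedded D t H ip"

lemma completion_represented:
  assumes "completes D t" and "(x, y) \<in> T" and "v \<in> D"
  shows "t x v = ip y v"
proof -
  interpret K: krein D t
    by (rule kreinI) (use assms(1) in \<open>simp add: krein_completion_def\<close>)
  obtain C where "D \<subseteq> H" and C: "\<And>x. x \<in> D \<Longrightarrow> nrm x \<le> C * K.hil.nrm x"
    using assms(1) K.continuously_embedded_iff[OF hilbert_axioms] by blast
  have dom: "Domain T \<subseteq> D" using assms(1) by (simp add: krein_completion_def)
  show ?thesis
  proof (rule form_extends_by_density[OF K.hil.hilbert_axioms \<open>D \<subseteq> H\<close> C K.space K.bounded dom])
    show "\<forall>x\<in>D. \<forall>e>0. \<exists>w\<in>Domain T. K.hil.nrm (x - w) < e"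
      using assms(1) K.krein_dense_iff[OF dom] by (simp add: krein_completion_def)
  qed (use assms in \<open>auto simp: krein_completion_def\<close>)
qed

lemma completion_gap_point_0:
  assumes "completes D t"
  shows "form H ip D t" and "gap_point H ip D t 0"
proof -
  interpret K: krein D t
    by (rule kreinI) (use assms in \<open>simp add: krein_completion_def\<close>)
  have DH: "D \<subseteq> H" and dom: "Domain T \<subseteq> D"
    using assms by (simp_all add: continuously_embedded_def krein_completion_def)
  have "ip_topology H ip closure_of D = H"
    unfolding dense_iff[OF DH]
    using dom_dense dense_iff[of "Domain T"] dom DH by (meson order_trans subsetD)
  then show "form H ip D t"
    using K.space DH by (simp add: form_def inner_product_space_def)
  show "gap_point H ip D t 0"
    using assms K.krein by (simp add: gap_point_def shifted_form_0[OF K.ip_extensional])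
qed

lemma completion_represents: "completes D t \<Longrightarrow> represents H ip D t T"
  using self_adjoint completion_represented[of D t] op_app_T
  by (auto simp: represents_def krein_completion_def)

lemma completion_representing_operator:
  assumes "completes D t"
  shows "representing_operator H ip D t = T"
proof (rule representing_operator_eq[OF space _ completion_represents[OF assms]])
  show "inner_product_space D t" using assms by (simp add: krein_completion_def krein_space_def)
qed

lemma completion_range_restriction:
  assumes "completes D t"
  shows "range_restriction H ip D t = op_restrict T (T\<inverse> `` D)"
  unfolding range_restriction_def completion_representing_operator[OF assms] Let_def
  by (auto simp: op_restrict_def op_app_T dest: T_unique)

text \<open>The test vector \<open>y = Jx - l T\<^sup>-\<^sup>1 Jx\<close>, for \<open>J\<close> the fundamental symmetry of the gap point \<open>l\<close>, shows that \<open>t\<close>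
itself makes \<open>D\<close> a Krein space: the term \<open>-l t[x,T\<^sup>-\<^sup>1 Jx] = -l(x,Jx)\<close> cancels the difference between
\<open>t\<close> and \<open>t\<^sub>l\<close> at \<open>(x,Jx)\<close>. Embedding and density carry over because the norms are equivalent.\<close>

theorem gap_point_moves_to_0:
  assumes "form_closure H ip D t (Domain T) (op_form ip T)"
  shows "completes D t"
proof -
  obtain l where gap: "gap_point H ip D t l"
    and dense: "krein_topology D (shifted_form ip D t l) closure_of Domain T = D"
    using assms by (auto simp: form_closure_def)
  have dom: "Domain T \<subseteq> D" and ext: "\<forall>u\<in>Domain T. \<forall>v\<in>Domain T. t u v = op_form ip T u v"
    using assms by (auto simp: form_closure_def form_extension_def)
  have form: "form H ip D t" using assms by (simp add: form_closure_def closed_form_def)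
  then have t: "inner_product_space D t" by (simp add: form_def inner_product_space_def)
  interpret t: inner_product D t by unfold_locales (rule t)
  let ?s = "shifted_form ip D t l"
  interpret K: krein D ?s
    by (rule kreinI) (use gap in \<open>simp add: gap_point_def\<close>)
  obtain C0 where DH: "D \<subseteq> H" and C0: "\<And>x. x \<in> D \<Longrightarrow> nrm x \<le> C0 * K.hil.nrm x"
    using gap K.continuously_embedded_iff[OF hilbert_axioms] by (auto simp: gap_point_def)
  have DinH: "x \<in> H" if "x \<in> D" for x using that DH by blast
  define C where "C = \<bar>C0\<bar>"
  have C: "C \<ge> 0" "nrm x \<le> C * K.hil.nrm x" if "x \<in> D" for x
  proof -
    have "C0 * K.hil.nrm x \<le> C * K.hil.nrm x" using that by (intro mult_right_mono) (auto simp: C_def)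
    then show "nrm x \<le> C * K.hil.nrm x" using C0[OF that] by linarith
  qed (simp add: C_def)
  have t_eq: "t x y = ?s x y + complex_of_real l * ip x y" if "x \<in> D" "y \<in> D" for x y
    using that by (simp add: shifted_form_def)
  have bounded: "K.hil.bounded_form t"
    unfolding K.hil.bounded_form_def
  proof (intro exI ballI)
    fix x y assume xy: "x \<in> D" "y \<in> D"
    have "cmod (ip x y) \<le> nrm x * nrm y" using cauchy_schwarz xy DinH by blast
    also have "\<dots> \<le> (C * K.hil.nrm x) * (C * K.hil.nrm y)"
      using C xy DinH by (intro mult_mono) auto
    finally have "\<bar>l\<bar> * cmod (ip x y) \<le> \<bar>l\<bar> * ((C * K.hil.nrm x) * (C * K.hil.nrm y))"
      by (intro mult_left_mono) auto
    moreover have "cmod (t x y) \<le> cmod (?s x y) + \<bar>l\<bar> * cmod (ip x y)"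
      unfolding t_eq[OF xy] using norm_triangle_ineq[of "?s x y" "complex_of_real l * ip x y"]
      by (simp add: norm_mult)
    ultimately show "cmod (t x y) \<le> (1 + \<bar>l\<bar> * C\<^sup>2) * K.hil.nrm x * K.hil.nrm y"
      using K.form_le[OF xy] by (simp add: algebra_simps power2_eq_square)
  qed
  have rep: "t x v = ip y v" if "(x, y) \<in> T" "v \<in> D" for x y v
  proof (rule form_extends_by_density[OF K.hil.hilbert_axioms DH C(2) t bounded dom _ ext that])
    show "\<forall>x\<in>D. \<forall>e>0. \<exists>w\<in>Domain T. K.hil.nrm (x - w) < e"
      using dense K.krein_dense_iff[OF dom] by simp
  qed
  obtain B where B: "B \<ge> 0" "\<forall>(x, y)\<in>T. K.hil.nrm x \<le> B * nrm y"
    using inverse_bounded_into_form_domain[OF K.krein DH C(2) dom rep] by blast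
  have inf_sup: "K.hil.inf_sup_form t"
    unfolding K.hil.inf_sup_form_def
  proof (intro exI ballI)
    fix x assume x: "x \<in> D"
    have Jx: "K.J x \<in> D" by (rule K.J_linear(1)[OF x])
    obtain z where z: "(z, K.J x) \<in> T" using T_surj DinH[OF Jx] by blast
    have zD: "z \<in> D" using z dom by blast
    let ?y = "K.J x - complex_of_real l *\<^sub>C z"
    have "t x z = ip x (K.J x)"
      using rep[OF z x] t.ip_commute[OF zD x] ip_commute[OF DinH[OF Jx] DinH[OF x]] by simp
    then have "t x ?y = t x (K.J x) - complex_of_real l * ip x (K.J x)"
      using x Jx zD by (simp add: t.ip_linear)
    then have "t x ?y = of_real ((K.hil.nrm x)\<^sup>2)"
      unfolding t_eq[OF x Jx] K.form_J[OF x] by simp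
    moreover have "K.hil.nrm ?y \<le> (1 + \<bar>l\<bar> * (B * C)) * K.hil.nrm x"
    proof -
      have "K.hil.nrm z \<le> B * nrm (K.J x)" using B(2) z by auto
      also have "\<dots> \<le> B * (C * K.hil.nrm x)"
        using C(2)[OF Jx] K.nrm_J[OF x] B(1) by (intro mult_left_mono) auto
      finally have "\<bar>l\<bar> * K.hil.nrm z \<le> \<bar>l\<bar> * (B * (C * K.hil.nrm x))"
        by (intro mult_left_mono) auto
      then show ?thesis
        using K.hil.nrm_triangle_diff[OF Jx K.hil.scale_in[OF zD, of "complex_of_real l"]]
          K.nrm_J[OF x] zD by (simp add: K.hil.nrm_scale algebra_simps)
    qed
    ultimately show "\<exists>y\<in>D. K.hil.nrm y \<le> (1 + \<bar>l\<bar> * (B * C)) * K.hil.nrm x \<and>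
        t x y = of_real ((K.hil.nrm x)\<^sup>2)"
      using Jx zD by (intro bexI[of _ ?y]) auto
  qed
  interpret K0: krein D t
    by (rule kreinI) (rule K.hil.krein_space_criterion[OF t bounded inf_sup])
  obtain A where A: "\<And>x. x \<in> D \<Longrightarrow> K.hil.nrm x \<le> A * K0.hil.nrm x"
    using norm_le_of_common_form[OF K.hil.hilbert_axioms K0.hil.hilbert_axioms t bounded K0.bounded inf_sup]
    by blast
  obtain A' where A': "\<And>x. x \<in> D \<Longrightarrow> K0.hil.nrm x \<le> A' * K.hil.nrm x"
    using norm_le_of_common_form[OF K0.hil.hilbert_axioms K.hil.hilbert_axioms t K0.bounded bounded K0.inf_sup]
    by blast
  have "nrm x \<le> (C * A) * K0.hil.nrm x" if "x \<in> D" for x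
    using C(2)[OF that] mult_left_mono[OF A[OF that] C(1)[OF that]] by simp
  then have "continuously_embedded D t H ip"
    using K0.continuously_embedded_iff[OF hilbert_axioms] DH by blast
  moreover have "krein_topology D t closure_of Domain T = D"
    unfolding K0.krein_dense_iff[OF dom]
  proof (intro ballI allI impI)
    fix x and e :: real assume x: "x \<in> D" and e: "e > 0"
    have "e / (\<bar>A'\<bar> + 1) > 0" using e by simp
    then obtain w where w: "w \<in> Domain T" "K.hil.nrm (x - w) < e / (\<bar>A'\<bar> + 1)"
      using dense K.krein_dense_iff[OF dom] x by blast
    have xw: "x - w \<in> D" using x w dom by blast
    have "K0.hil.nrm (x - w) \<le> A' * K.hil.nrm (x - w)" by (rule A'[OF xw])
    also have "\<dots> \<le> (\<bar>A'\<bar> + 1) * K.hil.nrm (x - w)"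
      using xw by (intro mult_right_mono) auto
    also have "\<dots> < e" using w(2) by (simp add: field_simps)
    finally show "\<exists>w\<in>Domain T. K0.hil.nrm (x - w) < e" using w(1) by blast
  qed
  ultimately show ?thesis
    using K0.krein dom_subspace dom ext by (simp add: krein_completion_def)
qed

lemma completion_is_closure:
  assumes "completes D t"
  shows "form_closure H ip D t (Domain T) (op_form ip T)"
proof -
  have "t \<in> D \<rightarrow>\<^sub>E D \<rightarrow>\<^sub>E UNIV"
    using completion_gap_point_0(1)[OF assms] by (simp add: form_def hermitian_form_def)
  from shifted_form_0[OF this, of ip] show ?thesis
    using completion_gap_point_0[OF assms] assms
    unfolding form_closure_def closed_form_def form_extension_def krein_completion_def
    by (intro conjI exI[of _ 0]) auto
qed

lemma closure_iff_completes: "(D, t) \<in> Closures_of_op H ip T \<longleftrightarrow> completes D t"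
  unfolding Closures_of_op_def mem_Collect_eq case_prod_conv
  by (rule iffI) (erule gap_point_moves_to_0, erule completion_is_closure)

text \<open>Since the representing operator is a definite description, the equation \<open>representing_operator H ip D t = T\<close> says
something about \<open>T\<close> only once a representing operator is known to exist.\<close>

lemma form_triple_completes:
  assumes "(H, ip, D, t) \<in> Form_triples" and "representing_operator H ip D t = T"
  shows "completes D t"
proof -
  have form: "form H ip D t" and gap: "gap_point H ip D t 0"
    using assms(1) by (auto simp: Form_triples_def closed_form_def)
  have "t \<in> D \<rightarrow>\<^sub>E D \<rightarrow>\<^sub>E UNIV" using form by (simp add: form_def hermitian_form_def)
  then have krein: "krein_space D t" and emb: "continuously_embedded D t H ip"
    using gap by (simp_all add: gap_point_def shifted_form_0)
  interpret K: krein D t by (rule kreinI[OF krein])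
  have H: "hilbert_space H ip" using assms(1) by (simp add: Form_triples_def)
  obtain S where S: "represents H ip D t S"
    using representing_operator_exists[OF H krein emb] form by (auto simp: form_def)
  then have T: "represents H ip D t T"
    using representing_operator_eq[OF space K.space S] assms(2) by simp
  have dom: "Domain T \<subseteq> D" using T by (simp add: represents_def)
  have rep: "t x v = ip y v" if "(x, y) \<in> T" "v \<in> D" for x y v
    using T that op_app_T[OF that(1)] by (auto simp: represents_def)
  have DinH: "x \<in> H" if "x \<in> D" for x using emb that by (auto simp: continuously_embedded_def)
  have "krein_topology D t closure_of Domain T = D"
    unfolding krein_topology_def
  proof (rule K.hil.dense_of_orthogonal_trivial[OF dom_subspace dom])
    fix v assume v: "v \<in> D" and orth: "\<And>w. w \<in> Domain T \<Longrightarrow> K.h v w = 0"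
    have Jv: "K.J v \<in> D" by (rule K.J_linear(1)[OF v])
    have "K.J v = 0"
    proof (rule eq_zeroI[OF DinH[OF Jv]])
      fix f assume f: "f \<in> H"
      obtain x where x: "(x, f) \<in> T" using T_surj[OF f] by blast
      then have "x \<in> D" using dom by blast
      have "ip f (K.J v) = K.h x v"
        using rep[OF x Jv] K.h_eq'[OF \<open>x \<in> D\<close> v] by simp
      then have "ip f (K.J v) = 0"
        using orth[of x] x K.hil.ip_commute[OF v \<open>x \<in> D\<close>] by auto
      then show "ip (K.J v) f = 0" using ip_commute[OF f DinH[OF Jv]] by simp
    qed
    then show "v = 0" using K.J_J[OF v] K.J_linear(5) by simp
  qed
  moreover have "t x y = op_form ip T x y" if xy: "x \<in> Domain T" "y \<in> Domain T" for x y
  proof -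
    obtain z where z: "(x, z) \<in> T" using xy(1) by blast
    show ?thesis using rep[OF z, of y] op_form_T[OF z xy(2)] dom xy(2) by auto
  qed
  ultimately show ?thesis
    using krein emb dom_subspace dom by (simp add: krein_completion_def)
qed

text \<open>Everything follows from \<open>[x,v] = (Ax,v)\<close> for \<open>x \<in> dom A\<close> and \<open>v \<in> K\<close>, together with the fact that \<open>A\<close> maps
onto \<open>K\<close>. For self-adjointness, let \<open>(v,w)\<close> be in the adjoint of \<open>JA\<close> and choose \<open>z\<close> with \<open>Az = Jw\<close>; both \<open>v\<close>
and \<open>z\<close> then have the same inner products with the range of \<open>JA\<close>, which is \<open>K\<close>.\<close>

lemma completion_Krein_triple:
  assumes "completes K t"
  shows "(K, t, op_restrict T (T\<inverse> `` K)) \<in> Krein_triples"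
proof -
  interpret K: krein K t
    by (rule kreinI) (use assms in \<open>simp add: krein_completion_def\<close>)
  note rep = completion_represented[OF assms]
  obtain C where KH: "K \<subseteq> H" and C: "\<And>x. x \<in> K \<Longrightarrow> nrm x \<le> C * K.hil.nrm x"
    using assms K.continuously_embedded_iff[OF hilbert_axioms] by blast
  have KinH: "x \<in> H" if "x \<in> K" for x using that KH by blast
  have dom: "Domain T \<subseteq> K" using assms by (simp add: krein_completion_def)
  define A where "A = op_restrict T (T\<inverse> `` K)"
  have A_iff: "(x, y) \<in> A \<longleftrightarrow> (x, y) \<in> T \<and> y \<in> K" for x y
    using T_unique by (auto simp: A_def op_restrict_def)
  have AK: "x \<in> K" "y \<in> K" if "(x, y) \<in> A" for x y using that dom by (auto simp: A_iff)
  have A_surj: "\<exists>x. (x, y) \<in> A" if "y \<in> K" for y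
    using T_surj[OF KinH[OF that]] that by (auto simp: A_iff)
  have repA: "t x v = ip y v" if "(x, y) \<in> A" "v \<in> K" for x y v
    using rep that by (auto simp: A_iff)
  have lin: "linear_operator K A"
    unfolding linear_operator_def
  proof (intro conjI)
    show "A \<subseteq> K \<times> K" using AK by auto
    show "single_valued A" using T_unique by (auto simp: single_valued_def A_iff)
    show "(0, 0) \<in> A" using T_zero by (simp add: A_iff)
    show "\<forall>(x, y)\<in>A. \<forall>(x', y')\<in>A. (x + x', y + y') \<in> A" using T_add by (auto simp: A_iff)
    show "\<forall>c. \<forall>(x, y)\<in>A. (c *\<^sub>C x, c *\<^sub>C y) \<in> A" using T_scale by (auto simp: A_iff)
  qed
  have subA: "complex_vector.subspace (Domain A)"
    by (rule Domain_linear_operator_subspace[OF lin])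
  have "krein_topology K t closure_of Domain A = K"
    unfolding krein_topology_def
  proof (rule K.hil.dense_of_orthogonal_trivial[OF subA])
    show "Domain A \<subseteq> K" using AK by blast
    fix v assume v: "v \<in> K" and orth: "\<And>w. w \<in> Domain A \<Longrightarrow> K.h v w = 0"
    have Jv: "K.J v \<in> K" by (rule K.J_linear(1)[OF v])
    obtain x where x: "(x, K.J v) \<in> A" using A_surj[OF Jv] by blast
    have "ip (K.J v) (K.J v) = K.h x v"
      using repA[OF x Jv] K.h_eq'[OF AK(1)[OF x] v] by simp
    then have "ip (K.J v) (K.J v) = 0"
      using orth[of x] x K.hil.ip_commute[OF v AK(1)[OF x]] by auto
    then have "K.J v = 0" using ip_self_pos[OF KinH[OF Jv]] by fastforce
    then show "v = 0" using K.J_J[OF v] K.J_linear(5) by simp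
  qed
  then have dense: "densely_defined (krein_topology K t) A" "densely_defined (krein_topology K t) (J_op K t A)"
    by (auto simp: densely_defined_def krein_topology_def K.hil.ip_topology_eq J_op_def Domain_unfold)
  have nonneg: "non_negative_op K.h (J_op K t A)"
    unfolding non_negative_op_def J_op_def
  proof clarify
    fix x y assume xy: "(x, y) \<in> A"
    have "K.h (K.J y) x = cnj (t x y)"
      using AK[OF xy] K.ip_commute[of x y] by (simp add: K.h_eq K.J_linear K.J_J)
    then have "K.h (K.J y) x = of_real ((nrm y)\<^sup>2)"
      using repA[OF xy AK(2)[OF xy]] ip_self[OF KinH[OF AK(2)[OF xy]]] by simp
    then show "K.h (K.J y) x \<in> \<real>\<^sub>\<ge>\<^sub>0" by (simp del: of_real_power)
  qed
  have J_op_iff: "(x, w) \<in> J_op K t A \<longleftrightarrow> w \<in> K \<and> (x, K.J w) \<in> A" for x w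
    using AK K.J_J K.J_linear(1) by (force simp: J_op_def)
  have linJ: "linear_operator K (J_op K t A)"
    unfolding linear_operator_def
  proof (intro conjI)
    show "J_op K t A \<subseteq> K \<times> K" using AK by (auto simp: J_op_iff)
    show "single_valued (J_op K t A)"
      using T_unique K.J_J by (auto simp: single_valued_def J_op_iff A_iff) metis
    show "(0, 0) \<in> J_op K t A" using T_zero by (simp add: J_op_iff A_iff K.J_linear)
    show "\<forall>(x, y)\<in>J_op K t A. \<forall>(x', y')\<in>J_op K t A. (x + x', y + y') \<in> J_op K t A"
      using T_add by (auto simp: J_op_iff A_iff K.J_linear)
    show "\<forall>c. \<forall>(x, y)\<in>J_op K t A. (c *\<^sub>C x, c *\<^sub>C y) \<in> J_op K t A"
      using T_scale by (auto simp: J_op_iff A_iff K.J_linear)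
  qed
  have "op_adjoint K K.h (J_op K t A) = J_op K t A"
  proof (intro equalityI subsetI)
    fix p assume "p \<in> op_adjoint K K.h (J_op K t A)"
    then obtain v w where p: "p = (v, w)" and vw: "v \<in> K" "w \<in> K"
      and adj: "\<And>x y. (x, y) \<in> J_op K t A \<Longrightarrow> K.h y v = K.h x w"
      unfolding op_adjoint_def by blast
    have Jw: "K.J w \<in> K" by (rule K.J_linear(1)[OF vw(2)])
    obtain z where z: "(z, K.J w) \<in> A" using A_surj[OF Jw] by blast
    have "K.h v y = K.h z y" if y: "y \<in> K" for y
    proof -
      have Jy: "K.J y \<in> K" by (rule K.J_linear(1)[OF y])
      obtain x where x: "(x, K.J y) \<in> A" using A_surj[OF Jy] by blast
      have "K.h y v = K.h x w" using adj x y by (simp add: J_op_iff)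
      also have "\<dots> = ip (K.J y) (K.J w)"
        using repA[OF x Jw] K.h_eq'[OF AK(1)[OF x] vw(2)] by simp
      also have "\<dots> = cnj (t z (K.J y))"
        using repA[OF z Jy] ip_commute[OF KinH[OF Jw] KinH[OF Jy]] by simp
      also have "\<dots> = K.h y z"
        using K.h_eq'[OF AK(1)[OF z] y] K.hil.ip_commute[OF AK(1)[OF z] y] by simp
      finally show ?thesis
        using K.hil.ip_commute[OF y vw(1)] K.hil.ip_commute[OF y AK(1)[OF z]] by simp
    qed
    then have "v = z" using K.hil.eqI_ip[OF vw(1) AK(1)[OF z]] by blast
    then show "p \<in> J_op K t A" using p z vw by (simp add: J_op_iff)
  next
    fix p assume "p \<in> J_op K t A"
    then obtain v w where p: "p = (v, w)" and w: "w \<in> K" "(v, K.J w) \<in> A"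
      by (cases p) (auto simp: J_op_iff)
    have "K.h y v = K.h x w" if xy: "(x, y) \<in> J_op K t A" for x y
    proof -
      have y: "y \<in> K" "(x, K.J y) \<in> A" using xy by (auto simp: J_op_iff)
      have "K.h y v = cnj (t v (K.J y))"
        using K.h_eq'[OF AK(1)[OF w(2)] y(1)] K.hil.ip_commute[OF AK(1)[OF w(2)] y(1)] by simp
      also have "\<dots> = ip (K.J y) (K.J w)"
        using repA[OF w(2) AK(2)[OF y(2)]] ip_commute[OF KinH[OF AK(2)[OF w(2)]] KinH[OF AK(2)[OF y(2)]]]
        by simp
      also have "\<dots> = K.h x w"
        using repA[OF y(2) AK(2)[OF w(2)]] K.h_eq'[OF AK(1)[OF y(2)] w(1)] by simp
      finally show ?thesis .
    qed
    then show "p \<in> op_adjoint K K.h (J_op K t A)"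
      using p w AK by (auto simp: op_adjoint_def)
  qed
  then have sa: "self_adjoint K K.h (J_op K t A)"
    using linJ dense(2) by (simp add: self_adjoint_def krein_topology_def)
  have "shifted_form ip K t 0 = t" by (rule shifted_form_0[OF K.ip_extensional])
  then obtain B where B: "B \<ge> 0" "\<forall>(x, y)\<in>T. K.hil.nrm x \<le> B * nrm y"
    using inverse_bounded_into_form_domain[of K t 0 C] K.krein KH C dom rep by auto
  have "boundedly_invertible K K.h A"
    unfolding boundedly_invertible_def
  proof (intro conjI lin)
    show "single_valued (A\<inverse>)" using T_inj by (auto simp: single_valued_def A_iff)
    show "Range A = K" using A_surj AK by blast
    have "ip_dist K K.h x 0 \<le> (B * C) * ip_dist K K.h y 0" if xy: "(x, y) \<in> A" for x y
    proof -
      have "K.hil.nrm x \<le> B * nrm y" using B(2) xy by (auto simp: A_iff)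
      also have "\<dots> \<le> B * (C * K.hil.nrm y)" by (intro mult_left_mono C AK(2)[OF xy] B(1))
      finally show ?thesis using AK[OF xy] by (simp add: K.hil.ip_dist_nrm mult.assoc)
    qed
    then show "\<exists>C. \<forall>(x, y)\<in>A. ip_dist K K.h x 0 \<le> C * ip_dist K K.h y 0" by blast
  qed
  then show ?thesis
    using K.krein lin dense(1) nonneg sa
    by (simp add: Krein_triples_def J_non_negative_def J_self_adjoint_def flip: A_def)
qed

lemma completions_iff:
  "(D, t, A) \<in> Completions_of_op H ip T \<longleftrightarrow> completes D t \<and> A = range_restriction H ip D t"
  using completion_range_restriction[of D t] by (auto simp: Completions_of_op_def)

end

theorem theorem5p2:
  fixes H :: "'a::complex_vector set"
    and ip :: "'a \<Rightarrow> 'a \<Rightarrow> complex"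
    and T :: "('a \<times> 'a) set"
  assumes "hilbert_space H ip"
    and "self_adjoint H ip T"
    and "boundedly_invertible H ip T"
  shows "bij_betw (\<lambda>(D, t). (D, t, range_restriction H ip D t))
           (Closures_of_op H ip T) (Completions_of_op H ip T)
         \<and> Completions_of_op H ip T \<subseteq> Krein_triples
         \<and> Closures_of_op H ip T =
             {(D, t). (H, ip, D, t) \<in> Form_triples \<and> representing_operator H ip D t = T}"
proof -
  interpret hilbert H ip by (rule hilbertI[OF assms(1)])
  interpret T: invertible_self_adjoint H ip T by unfold_locales (fact assms)+
  show ?thesis
  proof (intro conjI)
    show "bij_betw (\<lambda>(D, t). (D, t, range_restriction H ip D t))
        (Closures_of_op H ip T) (Completions_of_op H ip T)"
      unfolding bij_betw_def
    proof
      show "inj_on (\<lambda>(D, t). (D, t, range_restriction H ip D t)) (Closures_of_op H ip T)"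
        by (auto simp: inj_on_def)
      show "(\<lambda>(D, t). (D, t, range_restriction H ip D t)) ` Closures_of_op H ip T =
          Completions_of_op H ip T"
      proof (intro equalityI subsetI)
        fix p assume "p \<in> (\<lambda>(D, t). (D, t, range_restriction H ip D t)) ` Closures_of_op H ip T"
        then show "p \<in> Completions_of_op H ip T"
          using T.closure_iff_completes T.completions_iff by auto
      next
        fix p assume "p \<in> Completions_of_op H ip T"
        then obtain D t where "p = (D, t, range_restriction H ip D t)" "(D, t) \<in> Closures_of_op H ip T"
          using T.closure_iff_completes T.completions_iff by (cases p) auto
        then show "p \<in> (\<lambda>(D, t). (D, t, range_restriction H ip D t)) ` Closures_of_op H ip T"
          by (intro image_eqI[of _ _ "(D, t)"]) auto
      qed
    qed
    show "Completions_of_op H ip T \<subseteq> Krein_triples"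
      using T.completion_Krein_triple T.completion_range_restriction T.completions_iff by auto
    show "Closures_of_op H ip T =
        {(D, t). (H, ip, D, t) \<in> Form_triples \<and> representing_operator H ip D t = T}"
    proof (intro equalityI subrelI)
      fix D t
      assume "(D, t) \<in> Closures_of_op H ip T"
      then have c: "T.completes D t" by (simp add: T.closure_iff_completes)
      then show "(D, t) \<in> {(D, t). (H, ip, D, t) \<in> Form_triples \<and> representing_operator H ip D t = T}"
        using T.completion_gap_point_0[OF c] T.completion_representing_operator[OF c] assms(1)
        by (auto simp: Form_triples_def closed_form_def)
    next
      fix D t
      assume "(D, t) \<in> {(D, t). (H, ip, D, t) \<in> Form_triples \<and> representing_operator H ip D t = T}"
      then show "(D, t) \<in> Closures_of_op H ip T"
        using T.form_triple_completes T.closure_iff_completes by auto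
    qed
  qed
qed

end
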